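(* Let $n$ be a positive integer, let $x_1\ge x_2\ge\cdots\ge x_n$ be real numbers, and define $$y_k=-\sum_{j=0}^{k-1}(-1)^j\binom{k-1}{j}\,x_{k-j},\qquad k=1,\dots,n$$ (so $y_1=-x_1$, $y_2=-x_2+x_1$, $y_3=-x_3+2x_2-x_1$, and so on). Then the volume of the permutohedron $P_n=P_n(x_1,\dots,x_n)$ is $$\mathrm{Vol}\,P_n=\frac{1}{(n-1)!}\sum_{(J_1,\dots,J_{n-1})}y_{|J_1|}\cdots y_{|J_{n-1}|},$$ where the sum is over ordered collections of subsets $J_1,\dots,J_{n-1}\subseteq\{1,\dots,n\}$ such that, for any $k\ge1$ and any distinct $i_1,\dots,i_k\in\{1,\dots,n-1\}$, we have $|J_{i_1}\cup\cdots\cup J_{i_k}|\ge k+1$.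
   Context: The permutohedron $P_n(x_1,\dots,x_n)\subset\mathbb{R}^n$ is the convex hull of the points $(x_{w(1)},\dots,x_{w(n)})$, $w\in S_n$. For a polytope $P$ contained in a hyperplane $t_1+\cdots+t_n=c$ of $\mathbb{R}^n$, $\mathrm{Vol}\,P$ denotes the usual $(n-1)$-dimensional volume of the image of $P$ under the projection $(t_1,\dots,t_n)\mapsto(t_1,\dots,t_{n-1})$ (for $n=1$ the volume of a point is $1$, and the sum consists of a single empty product equal to $1$). *)

theory Defs
  imports "HOL-Analysis.Analysis" "HOL-Library.Function_Algebras" "HOL-Combinatorics.Permutations"
begin

(* Pointwise real vector space structure on functions, so that the library's convex hull
   applies to real^n with the number n a variable of the logic. *)

instantiation "fun" :: (type, real_vector) real_vector
begin

definition scaleR_fun :: "real \<Rightarrow> ('a \<Rightarrow> 'b) \<Rightarrow> 'a \<Rightarrow> 'b" where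
  "scaleR_fun c f = (\<lambda>i. c *\<^sub>R f i)"

instance
  by standard (auto simp: scaleR_fun_def plus_fun_def scaleR_add_left scaleR_add_right)

end

(* A point of real^n is a function on nat vanishing outside {1..n}. *)

definition permutohedron :: "nat \<Rightarrow> (nat \<Rightarrow> real) \<Rightarrow> (nat \<Rightarrow> real) set" where
  "permutohedron n x =
     convex hull {(\<lambda>i. if i \<in> {1..n} then x (w i) else 0) |w. w permutes {1..n}}"

(* For P in a hyperplane t 1 + ... + t n = c: the Lebesgue measure of the image of P under
   the projection that drops the n-th coordinate. The product measure lives on functions
   that are undefined outside {1..<n}, hence restrict. For n = 1 it is the unit point mass.
   The images of polytopes are compact, so the Borel product measure suffices. *)

definition hyperplane_vol :: "nat \<Rightarrow> (nat \<Rightarrow> real) set \<Rightarrow> real" where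
  "hyperplane_vol n P =
     measure (Pi\<^sub>M {1..<n} (\<lambda>_. lborel)) ((\<lambda>t. restrict t {1..<n}) ` P)"

(* A choice of distinct i_1, ..., i_k is encoded by the k-element set I of these indices. *)

definition dragon_collections :: "nat \<Rightarrow> (nat \<Rightarrow> nat set) set" where
  "dragon_collections n =
     {J \<in> {1..<n} \<rightarrow>\<^sub>E Pow {1..n}.
        \<forall>k\<ge>1. \<forall>I\<subseteq>{1..<n}. card I = k \<longrightarrow> card (\<Union>i\<in>I. J i) \<ge> k + 1}"

end

theory Submission
  imports Defs
begin

text \<open>
  Both sides satisfy the same recursion. Slicing the permutohedron of \<open>x\<close> by fixing one coordinate
  to \<open>s\<close> with \<open>x (k + 1) \<le> s \<le> x k\<close> gives the permutohedron of the sequence in which the two entries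
  \<open>x k, x (k + 1)\<close> are replaced by the single entry \<open>x k + x (k + 1) - s\<close>; this yields Rado's
  description by inequalities and, by Fubini, the volume as a sum of one-dimensional integrals.
  On the combinatorial side, fixing one set \<open>K\<close> of a dragon collection and an element \<open>u \<in> K\<close>, the
  other sets split uniquely along a facet \<open>I\<close> containing \<open>u\<close> but not \<open>K\<close> into a dragon collection
  on \<open>I\<close> and one on its complement. Hence the gradient of the polynomial on the right-hand side is
  the expected combination of facet volumes, and with Euler's relation for homogeneous polynomials
  this turns into the integral recursion.
\<close>

text \<open>The facet formula \<open>(n - 1) Vol P =\<close> sum of height times facet volume is
  never established for polytopes, only for the polynomial: Euler's relation turns the gradient into
  a sum over \<open>k\<close> of \<open>n choose k\<close> products of two smaller polynomials,
  weighted by \<open>x 1 + ... + x k - k c\<close>, where \<open>c\<close> is the mean of the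
  entries. The same relation for the merged sequence, integrated over the slabs, gives such products
  with coefficients \<open>n - 1 choose i\<close>, once from the entries before the merged one and
  once from those after it; Pascal's rule joins the two. The merged entry comes from two vertices
  that differ by exchanging the values \<open>x k\<close> and \<open>x (k + 1)\<close>: on the
  segment between them two coordinates vary with constant sum, so fixing one at \<open>s\<close>
  forces \<open>x k + x (k + 1) - s\<close> on the other. The merged sequence is guaranteed to be
  decreasing only for \<open>s\<close> between these two values, so slicing is piecewise. At a
  common breakpoint the two neighbouring pieces both amount to deleting that entry, which makes the
  boundary terms telescope.\<close>

section \<open>Iterated differences\<close>

text \<open>Equals \<open>- (\<Delta>\<^sup>k\<^sup>-\<^sup>1 x)(1)\<close> with the forward difference \<open>\<Delta>\<close>; junk for \<open>k = 0\<close>, which never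
  occurs since all sets in a dragon collection have at least two elements.\<close>

definition neg_diff :: "nat \<Rightarrow> (nat \<Rightarrow> real) \<Rightarrow> real" where
  "neg_diff k x = - (\<Sum>j = 0..k - 1. (-1) ^ j * real ((k - 1) choose j) * x (k - j))"

definition shift :: "nat \<Rightarrow> (nat \<Rightarrow> 'a) \<Rightarrow> nat \<Rightarrow> 'a" where
  "shift i x = (\<lambda>j. x (j + i))"

lemma shift_0 [simp]: "shift 0 x = x"
  by (simp add: shift_def)

lemma shift_shift: "shift i (shift j x) = shift (i + j) x"
  by (simp add: shift_def add.assoc)

lemma neg_diff_1 [simp]: "neg_diff (Suc 0) x = - x 1"
  by (simp add: neg_diff_def)

lemma neg_diff_Suc:
  assumes "k \<ge> 1"
  shows "neg_diff (Suc k) x = neg_diff k (shift 1 x) - neg_diff k x"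
proof -
  obtain m where k: "k = Suc m"
    using assms by (cases k) auto
  define f where "f j = (-1) ^ j * real (m choose j) * x (m + 2 - j)" for j
  have "(\<Sum>j = 0..Suc m. (-1) ^ j * real (Suc m choose j) * x (Suc (Suc m) - j))
      = x (m + 2) + (\<Sum>j = 0..m. f (Suc j) - (-1) ^ j * real (m choose j) * x (Suc m - j))"
    unfolding sum.atLeast0_atMost_Suc_shift
    by (simp add: f_def algebra_simps sum.distrib sum_subtractf sum_negf)
  also have "\<dots> = (\<Sum>j = 0..Suc m. f j) - (\<Sum>j = 0..m. (-1) ^ j * real (m choose j) * x (Suc m - j))"
    unfolding sum.atLeast0_atMost_Suc_shift by (simp add: f_def sum_subtractf)
  also have "(\<Sum>j = 0..Suc m. f j) = (\<Sum>j = 0..m. f j)"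
    by (simp add: f_def)
  also have "\<dots> = (\<Sum>j = 0..m. (-1) ^ j * real (m choose j) * shift 1 x (Suc m - j))"
    by (rule sum.cong) (auto simp: f_def shift_def Suc_diff_le)
  finally show ?thesis
    by (simp add: neg_diff_def k)
qed

lemma sum_Pow_insert_image:
  assumes "finite I" "a \<notin> I"
  shows "(\<Sum>M\<in>insert a ` Pow I. f (card M)) = (\<Sum>M\<in>Pow I. f (Suc (card M)))"
proof -
  have "inj_on (insert a) (Pow I)"
    using assms(2) by (intro inj_onI) (metis PowD insert_ident subsetD)
  hence "(\<Sum>M\<in>insert a ` Pow I. f (card M)) = (\<Sum>M\<in>Pow I. f (card (insert a M)))"
    by (simp add: sum.reindex)
  also have "\<dots> = (\<Sum>M\<in>Pow I. f (Suc (card M)))"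
  proof (rule sum.cong[OF refl])
    fix M assume "M \<in> Pow I"
    hence "finite M" "a \<notin> M" using assms finite_subset by auto
    thus "f (card (insert a M)) = f (Suc (card M))" by simp
  qed
  finally show ?thesis .
qed

text \<open>Binomial expansion of a shift as a power of \<open>1 + \<Delta>\<close>, with subsets in
  place of binomial coefficients. It explains why forgetting a set \<open>I\<close> of elements
  turns the weights of \<open>x\<close> into those of \<open>x\<close> shifted by
  \<open>card I\<close>.\<close>

lemma neg_diff_sum_Pow:
  assumes "finite I" "k \<ge> 1"
  shows "(\<Sum>M\<in>Pow I. neg_diff (k + card M) x) = neg_diff k (shift (card I) x)"
  using assms
proof (induction I arbitrary: k rule: finite_induct)
  case (insert a I)
  have "(\<Sum>M\<in>Pow (insert a I). neg_diff (k + card M) x)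
      = (\<Sum>M\<in>Pow I. neg_diff (k + card M) x) + (\<Sum>M\<in>insert a ` Pow I. neg_diff (k + card M) x)"
    unfolding Pow_insert using insert.hyps by (intro sum.union_disjoint) auto
  also have "(\<Sum>M\<in>insert a ` Pow I. neg_diff (k + card M) x) = (\<Sum>M\<in>Pow I. neg_diff (Suc k + card M) x)"
    using sum_Pow_insert_image[OF insert.hyps, of "\<lambda>m. neg_diff (k + m) x"] by simp
  also have "(\<Sum>M\<in>Pow I. neg_diff (k + card M) x) + \<dots> = neg_diff k (shift 1 (shift (card I) x))"
    using insert.IH[of k] insert.IH[of "Suc k"] insert.prems by (simp add: neg_diff_Suc)
  finally show ?case
    using insert.hyps by (simp add: shift_shift)
qed auto

text \<open>A new element \<open>a\<close> contributes the subsets containing it, whose weights add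
  up to \<open>neg_diff 1\<close> of the shifted sequence, that is to
  \<open>- x (card I + 1)\<close>. These partial sums later become the facet speeds in the
  gradient.\<close>

lemma neg_diff_sum_nonempty:
  assumes "finite I"
  shows "(\<Sum>M\<in>Pow I - {{}}. neg_diff (card M) x) = - (\<Sum>j = 1..card I. x j)"
  using assms
proof (induction I rule: finite_induct)
  case (insert a I)
  have eq: "Pow (insert a I) - {{}} = (Pow I - {{}}) \<union> insert a ` Pow I"
    unfolding Pow_insert by auto
  have "(\<Sum>M\<in>Pow (insert a I) - {{}}. neg_diff (card M) x)
      = (\<Sum>M\<in>Pow I - {{}}. neg_diff (card M) x) + (\<Sum>M\<in>insert a ` Pow I. neg_diff (card M) x)"
    unfolding eq using insert.hyps by (intro sum.union_disjoint) auto
  also have "(\<Sum>M\<in>insert a ` Pow I. neg_diff (card M) x) = (\<Sum>M\<in>Pow I. neg_diff (1 + card M) x)"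
    using sum_Pow_insert_image[OF insert.hyps, of "\<lambda>m. neg_diff m x"] by simp
  finally show ?case
    using insert neg_diff_sum_Pow[of I 1 x] by (simp add: shift_def)
qed auto

section \<open>Splitting dragon collections along a facet\<close>

text \<open>Hall's condition with surplus one. Index set and ground set are arbitrary, because
  splitting along a facet leads to arbitrary subsets of both.\<close>

definition dragons :: "'i set \<Rightarrow> 'e set \<Rightarrow> ('i \<Rightarrow> 'e set) set" where
  "dragons A U = {J \<in> A \<rightarrow>\<^sub>E Pow U. \<forall>I\<subseteq>A. I \<noteq> {} \<longrightarrow> card I < card (\<Union>i\<in>I. J i)}"

definition dragon_sum :: "'i set \<Rightarrow> 'e set \<Rightarrow> (nat \<Rightarrow> real) \<Rightarrow> real" where
  "dragon_sum A U w = (\<Sum>J\<in>dragons A U. \<Prod>i\<in>A. w (card (J i)))"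

text \<open>\<open>J\<close> on \<open>A\<close> restricts to a dragon collection of subsets of \<open>I\<close> on \<open>A'\<close>, and modulo \<open>I\<close> to one on the
  remaining indices.\<close>

definition splits :: "'i set \<Rightarrow> 'e set \<Rightarrow> 'i set \<Rightarrow> ('i \<Rightarrow> 'e set) \<Rightarrow> bool" where
  "splits A I A' J \<longleftrightarrow>
     (\<forall>i\<in>A'. J i \<subseteq> I) \<and>
     (\<forall>T\<subseteq>A'. T \<noteq> {} \<longrightarrow> card T < card (\<Union>i\<in>T. J i)) \<and>
     (\<forall>T\<subseteq>A - A'. T \<noteq> {} \<longrightarrow> card T < card (\<Union>i\<in>T. J i - I))"

lemma dragons_card:
  assumes "J \<in> dragons A U" "i \<in> A"
  shows "card (J i) \<ge> 2"
proof -
  have "card {i} < card (\<Union>j\<in>{i}. J j)"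
    using assms unfolding dragons_def by blast
  thus ?thesis by simp
qed

text \<open>For \<open>i\<close> outside \<open>A'\<close> the trace of \<open>J i\<close> on
  \<open>I\<close> is subject to no condition. Choosing these traces freely replaces the weight
  \<open>w k\<close> by the sum of \<open>w (k + card M)\<close> over all
  \<open>M \<subseteq> I\<close>.\<close>

lemma splits_sum:
  assumes "finite A" "finite U" "A' \<subseteq> A" "I \<subseteq> U"
  shows "(\<Sum>J | J \<in> A \<rightarrow>\<^sub>E Pow U \<and> splits A I A' J. \<Prod>i\<in>A. w (card (J i)))
       = dragon_sum A' I w * dragon_sum (A - A') (U - I) (\<lambda>k. \<Sum>M\<in>Pow I. w (k + card M))"
proof -
  let ?B = "A - A'"
  have fin: "finite A'" "finite I" "finite ?B"
    using assms finite_subset by blast+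
  have "dragon_sum ?B (U - I) (\<lambda>k. \<Sum>M\<in>Pow I. w (k + card M))
      = (\<Sum>J2\<in>dragons ?B (U - I). \<Sum>m\<in>?B \<rightarrow>\<^sub>E Pow I. \<Prod>i\<in>?B. w (card (J2 i) + card (m i)))"
    unfolding dragon_sum_def using fin by (simp add: prod_sum_PiE)
  hence "dragon_sum A' I w * dragon_sum ?B (U - I) (\<lambda>k. \<Sum>M\<in>Pow I. w (k + card M))
      = (\<Sum>(J1, J2, m)\<in>dragons A' I \<times> dragons ?B (U - I) \<times> (?B \<rightarrow>\<^sub>E Pow I).
          (\<Prod>i\<in>A'. w (card (J1 i))) * (\<Prod>i\<in>?B. w (card (J2 i) + card (m i))))"
    unfolding dragon_sum_def[of A']
    by (simp only:, subst sum_distrib_right)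
       (simp add: sum_distrib_left flip: sum.cartesian_product)
  also have "\<dots> = (\<Sum>J | J \<in> A \<rightarrow>\<^sub>E Pow U \<and> splits A I A' J. \<Prod>i\<in>A. w (card (J i)))"
  proof (rule sum.reindex_bij_witness[where
        i = "\<lambda>J. (restrict J A', restrict (\<lambda>i. J i - I) ?B, restrict (\<lambda>i. J i \<inter> I) ?B)" and
        j = "\<lambda>(J1, J2, m). \<lambda>i. if i \<in> A' then J1 i else if i \<in> A then J2 i \<union> m i else undefined"], goal_cases)
    case (1 a)
    obtain J1 J2 m where a: "a = (J1, J2, m)" by (metis prod_cases3)
    have h: "J1 \<in> A' \<rightarrow>\<^sub>E Pow I" "J2 \<in> ?B \<rightarrow>\<^sub>E Pow (U - I)" "m \<in> ?B \<rightarrow>\<^sub>E Pow I"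
      using 1 a by (auto simp: dragons_def)
    have "J2 i \<union> m i - I = J2 i" "(J2 i \<union> m i) \<inter> I = m i" if "i \<in> ?B" for i
      using PiE_mem[OF h(2) that] PiE_mem[OF h(3) that] by auto
    moreover have "J1 i = undefined" if "i \<notin> A'" for i
      using h(1) that by (rule PiE_arb)
    moreover have "J2 i = undefined" "m i = undefined" if "i \<notin> ?B" for i
      using PiE_arb[OF h(2) that] PiE_arb[OF h(3) that] .
    ultimately show ?case
      using assms(3) by (auto simp: a fun_eq_iff)
  next
    case (2 a)
    obtain J1 J2 m where a: "a = (J1, J2, m)" by (metis prod_cases3)
    have h: "J1 \<in> A' \<rightarrow>\<^sub>E Pow I" "J2 \<in> ?B \<rightarrow>\<^sub>E Pow (U - I)" "m \<in> ?B \<rightarrow>\<^sub>E Pow I"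
      and d1: "\<And>T. T \<subseteq> A' \<Longrightarrow> T \<noteq> {} \<Longrightarrow> card T < card (\<Union>i\<in>T. J1 i)"
      and d2: "\<And>T. T \<subseteq> ?B \<Longrightarrow> T \<noteq> {} \<Longrightarrow> card T < card (\<Union>i\<in>T. J2 i)"
      using 2 a by (auto simp: dragons_def)
    let ?J = "\<lambda>i. if i \<in> A' then J1 i else if i \<in> A then J2 i \<union> m i else undefined"
    have e1: "(\<Union>i\<in>T. ?J i) = (\<Union>i\<in>T. J1 i)" if "T \<subseteq> A'" for T
      using that by (intro SUP_cong) auto
    have e2: "(\<Union>i\<in>T. ?J i - I) = (\<Union>i\<in>T. J2 i)" if "T \<subseteq> ?B" for T
    proof (intro SUP_cong refl)
      fix i assume "i \<in> T"
      hence "i \<in> ?B" using that by blast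
      thus "?J i - I = J2 i" using PiE_mem[OF h(2)] PiE_mem[OF h(3)] by fastforce
    qed
    have "splits A I A' ?J"
      unfolding splits_def
    proof (intro conjI allI impI ballI)
      show "?J i \<subseteq> I" if "i \<in> A'" for i using PiE_mem[OF h(1) that] that by auto
      show "card T < card (\<Union>i\<in>T. ?J i)" if "T \<subseteq> A'" "T \<noteq> {}" for T
        using e1[OF that(1)] d1[OF that] by simp
      show "card T < card (\<Union>i\<in>T. ?J i - I)" if "T \<subseteq> A - A'" "T \<noteq> {}" for T
        using e2[OF that(1)] d2[OF that] by simp
    qed
    moreover have "?J \<in> A \<rightarrow>\<^sub>E Pow U"
    proof (rule PiE_I)
      fix i assume "i \<in> A"
      show "?J i \<in> Pow U"
      proof (cases "i \<in> A'")
        case True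
        thus ?thesis using PiE_mem[OF h(1) True] assms(4) by auto
      next
        case False
        hence "i \<in> ?B" using \<open>i \<in> A\<close> by simp
        thus ?thesis using PiE_mem[OF h(2)] PiE_mem[OF h(3)] assms(4) False \<open>i \<in> A\<close> by fastforce
      qed
    qed (use assms(3) in auto)
    ultimately show ?case by (simp add: a)
  next
    case (3 J)
    hence "J i = undefined" if "i \<notin> A" for i
      using that by (auto dest: PiE_arb)
    thus ?case using assms(3) by (auto simp: fun_eq_iff)
  next
    case (4 J)
    hence J: "J \<in> A \<rightarrow>\<^sub>E Pow U" and s: "splits A I A' J" by auto
    have "(\<Union>i\<in>T. restrict J A' i) = (\<Union>i\<in>T. J i)" if "T \<subseteq> A'" for T
      using that by (intro SUP_cong) auto
    moreover have "(\<Union>i\<in>T. restrict (\<lambda>i. J i - I) ?B i) = (\<Union>i\<in>T. J i - I)" if "T \<subseteq> ?B" for T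
      using that by (intro SUP_cong) auto
    moreover have "restrict J A' \<in> A' \<rightarrow>\<^sub>E Pow I"
      using s by (intro PiE_I) (auto simp: splits_def)
    moreover have "restrict (\<lambda>i. J i - I) ?B \<in> ?B \<rightarrow>\<^sub>E Pow (U - I)"
      using PiE_mem[OF J] by (intro PiE_I) auto
    moreover have "restrict (\<lambda>i. J i \<inter> I) ?B \<in> ?B \<rightarrow>\<^sub>E Pow I"
      by (intro PiE_I) auto
    ultimately show ?case
      using s unfolding dragons_def splits_def mem_Times_iff fst_conv snd_conv mem_Collect_eq by metis
  next
    case (5 a)
    obtain J1 J2 m where a: "a = (J1, J2, m)" by (metis prod_cases3)
    have h: "J2 \<in> ?B \<rightarrow>\<^sub>E Pow (U - I)" "m \<in> ?B \<rightarrow>\<^sub>E Pow I"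
      using 5 a by (auto simp: dragons_def)
    have c: "card (J2 i \<union> m i) = card (J2 i) + card (m i)" if "i \<in> ?B" for i
    proof (rule card_Un_disjoint)
      have "J2 i \<subseteq> U - I" "m i \<subseteq> I"
        using PiE_mem[OF h(1) that] PiE_mem[OF h(2) that] by auto
      thus "finite (J2 i)" "finite (m i)" "J2 i \<inter> m i = {}"
        using fin assms(2) by (auto intro: finite_subset)
    qed
    have "A = A' \<union> ?B" using assms(3) by blast
    hence "(\<Prod>i\<in>A. f i) = (\<Prod>i\<in>A'. f i) * (\<Prod>i\<in>?B. f i)" for f :: "'a \<Rightarrow> real"
      using prod.union_disjoint[of A' ?B f] fin by auto
    thus ?case
      using c by (simp add: a)
  qed
  finally show ?thesis by simp
qed

text \<open>\<open>A'\<close> is the largest \<open>S\<close> for which the union of the \<open>J i\<close>, \<open>i \<in> S\<close>, together with \<open>u\<close> has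
  only \<open>card S + 1\<close> elements.\<close>

lemma splits_determined:
  assumes fin: "finite A" "finite U" and J: "J \<in> A \<rightarrow>\<^sub>E Pow U"
    and s: "splits A I A' J" and sub: "A' \<subseteq> A" "I \<subseteq> U" "u \<in> I" "card I = Suc (card A')"
  shows "I = insert u (\<Union>i\<in>A'. J i)"
    and "S \<subseteq> A \<Longrightarrow> card (insert u (\<Union>i\<in>S. J i)) \<le> Suc (card S) \<Longrightarrow> S \<subseteq> A'"
proof -
  have finI: "finite I" and finA': "finite A'"
    using fin sub finite_subset by blast+
  have JU: "J i \<subseteq> U" if "i \<in> A" for i
    using PiE_mem[OF J that] by simp
  have fJ: "finite (\<Union>i\<in>S. J i)" if "S \<subseteq> A" for S
    using that JU by (intro finite_subset[OF _ fin(2)]) auto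
  have sI: "\<And>i. i \<in> A' \<Longrightarrow> J i \<subseteq> I"
    and s1: "\<And>T. T \<subseteq> A' \<Longrightarrow> T \<noteq> {} \<Longrightarrow> card T < card (\<Union>i\<in>T. J i)"
    and s2: "\<And>T. T \<subseteq> A - A' \<Longrightarrow> T \<noteq> {} \<Longrightarrow> card T < card (\<Union>i\<in>T. J i - I)"
    using s unfolding splits_def by auto
  have N: "Suc (card T) \<le> card (insert u (\<Union>i\<in>T. J i))" if "T \<subseteq> A'" for T
  proof (cases "T = {}")
    case False
    have "card (\<Union>i\<in>T. J i) \<le> card (insert u (\<Union>i\<in>T. J i))"
      using fJ that sub by (intro card_mono) auto
    thus ?thesis using s1[OF that False] by simp
  qed simp
  have "insert u (\<Union>i\<in>A'. J i) \<subseteq> I"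
    using sI sub by auto
  moreover have "card I \<le> card (insert u (\<Union>i\<in>A'. J i))"
    using N[of A'] sub by simp
  ultimately show "I = insert u (\<Union>i\<in>A'. J i)"
    using card_seteq[OF finI] by metis
  assume S: "S \<subseteq> A" and le: "card (insert u (\<Union>i\<in>S. J i)) \<le> Suc (card S)"
  show "S \<subseteq> A'"
  proof (rule ccontr)
    assume "\<not> S \<subseteq> A'"
    hence ne: "S - A' \<noteq> {}" by blast
    \<comment> \<open>Elements inside and outside \<open>I\<close> are counted separately: inside
      there are at least \<open>card (S \<inter> A') + 1\<close>, and the surplus outside pushes the
      total above \<open>card S + 1\<close>.\<close>
    let ?N1 = "insert u (\<Union>i\<in>S \<inter> A'. J i)" and ?N2 = "\<Union>i\<in>S - A'. J i - I"
    have "S - A' \<subseteq> A - A'" using S by blast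
    hence "card (S - A') < card ?N2" using ne by (rule s2)
    moreover have "Suc (card (S \<inter> A')) \<le> card ?N1" by (rule N) simp
    moreover have "card S = card (S \<inter> A') + card (S - A')"
      using S fin(1) finite_subset card_Int_Diff by metis
    moreover have "card ?N1 + card ?N2 = card (?N1 \<union> ?N2)"
    proof (rule card_Un_disjoint[symmetric])
      show "finite ?N1" using fJ[of "S \<inter> A'"] S by auto
      have "finite (\<Union>i\<in>S. J i)" using fJ S by blast
      thus "finite ?N2" by (rule rev_finite_subset) blast
      show "?N1 \<inter> ?N2 = {}" using sI sub by auto
    qed
    moreover have "card (?N1 \<union> ?N2) \<le> card (insert u (\<Union>i\<in>S. J i))"
      using fJ[OF S] by (intro card_mono) auto
    ultimately show False using le by arith
  qed
qed

text \<open>Take a maximal \<open>A'\<close> for which \<open>u\<close> and the sets over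
  \<open>A'\<close> together have only \<open>card A' + 1\<close> elements, and let \<open>I\<close>
  be their union. Enlarging \<open>A'\<close> by \<open>T\<close> must then gain more than
  \<open>card T\<close> new elements, which is the condition modulo \<open>I\<close>. If
  \<open>K\<close> were contained in \<open>I\<close>, the indices \<open>a\<close> and
  \<open>A'\<close> together would violate the dragon condition.\<close>

lemma splits_exists:
  assumes fin: "finite A" "finite U" and J: "J \<in> A \<rightarrow>\<^sub>E Pow U" and a: "a \<notin> A"
    and K: "K \<subseteq> U" "u \<in> K" and d: "J(a := K) \<in> dragons (insert a A) U"
  shows "\<exists>I A'. splits A I A' J \<and> A' \<subseteq> A \<and> I \<subseteq> U \<and> u \<in> I \<and> \<not> K \<subseteq> I \<and> card I = Suc (card A')"
proof -
  have JU: "J i \<subseteq> U" if "i \<in> A" for i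
    using PiE_mem[OF J that] by simp
  have fJ: "finite (\<Union>i\<in>S. J i)" if "S \<subseteq> A" for S
    using that JU by (intro finite_subset[OF _ fin(2)]) auto
  have d0: "card T < card (\<Union>i\<in>T. (J(a := K)) i)" if "T \<subseteq> insert a A" "T \<noteq> {}" for T
    using d that unfolding dragons_def by blast
  have d1: "card T < card (\<Union>i\<in>T. J i)" if "T \<subseteq> A" "T \<noteq> {}" for T
  proof -
    have "(\<Union>i\<in>T. (J(a := K)) i) = (\<Union>i\<in>T. J i)"
      using that a by (intro SUP_cong) auto
    thus ?thesis using d0[of T] that by auto
  qed
  have d2: "Suc (card T) < card (K \<union> (\<Union>i\<in>T. J i))" if "T \<subseteq> A" for T
  proof -
    have "(\<Union>i\<in>T. (J(a := K)) i) = (\<Union>i\<in>T. J i)"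
      using that a by (intro SUP_cong) auto
    moreover have "card (insert a T) = Suc (card T)"
      using that a fin finite_subset by (subst card_insert_disjoint) auto
    ultimately have "(\<Union>i\<in>insert a T. (J(a := K)) i) = K \<union> (\<Union>i\<in>T. J i)"
      "card (insert a T) = Suc (card T)"
      by (simp_all only: UN_insert fun_upd_same)
    thus ?thesis using d0[of "insert a T"] that by (metis insert_mono insert_not_empty)
  qed
  define \<S> where "\<S> = {S. S \<subseteq> A \<and> card (insert u (\<Union>i\<in>S. J i)) = Suc (card S)}"
  have "finite \<S>" unfolding \<S>_def using fin by simp
  moreover have "{} \<in> \<S>" by (simp add: \<S>_def)
  ultimately obtain A' where A': "A' \<in> \<S>" and max: "\<And>S. S \<in> \<S> \<Longrightarrow> A' \<subseteq> S \<Longrightarrow> A' = S"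
    using finite_has_maximal[of \<S>] by auto
  define I where "I = insert u (\<Union>i\<in>A'. J i)"
  have A'A: "A' \<subseteq> A" and cI: "card I = Suc (card A')"
    using A' by (auto simp: \<S>_def I_def)
  have finI: "finite I" using fJ[OF A'A] by (simp add: I_def)
  have "splits A I A' J"
    unfolding splits_def
  proof (intro conjI ballI allI impI)
    fix T assume T: "T \<subseteq> A - A'" "T \<noteq> {}"
    let ?S = "A' \<union> T"
    have S: "?S \<subseteq> A" "?S \<noteq> {}" using T A'A by auto
    have "card (\<Union>i\<in>?S. J i) \<le> card (insert u (\<Union>i\<in>?S. J i))"
      by (intro card_mono) (use fJ[OF S(1)] in auto)
    hence "card ?S < card (insert u (\<Union>i\<in>?S. J i))"
      using d1[OF S] by linarith
    moreover have "?S \<notin> \<S>"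
      using max[of ?S] T by auto
    ultimately have "Suc (card ?S) < card (insert u (\<Union>i\<in>?S. J i))"
      using S by (auto simp: \<S>_def)
    also have "insert u (\<Union>i\<in>?S. J i) = I \<union> (\<Union>i\<in>T. J i - I)"
      by (auto simp: I_def)
    also have "card \<dots> \<le> card I + card (\<Union>i\<in>T. J i - I)"
      by (rule card_Un_le)
    finally show "card T < card (\<Union>i\<in>T. J i - I)"
      using cI T fin A'A finite_subset by (subst (asm) card_Un_disjoint) auto
  qed (use d1 A'A in \<open>auto simp: I_def\<close>)
  moreover have "I \<subseteq> U" using K JU A'A by (auto simp: I_def)
  moreover have "\<not> K \<subseteq> I"
  proof
    assume "K \<subseteq> I"
    hence "card (K \<union> (\<Union>i\<in>A'. J i)) \<le> card I"
      using finI by (intro card_mono) (auto simp: I_def)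
    thus False using d2[OF A'A] cI by simp
  qed
  ultimately show ?thesis
    using A'A cI by (intro exI[of _ I] exI[of _ A']) (auto simp: I_def)
qed

text \<open>Lower bounds inside and outside \<open>I\<close> add up. For index sets containing
  \<open>a\<close> an additional surplus is needed, and \<open>K\<close> supplies it by meeting both
  sides: \<open>u\<close> lies inside \<open>I\<close>, some other element of \<open>K\<close>
  outside.\<close>

lemma splits_dragon:
  assumes fin: "finite A" "finite U" and J: "J \<in> A \<rightarrow>\<^sub>E Pow U" and a: "a \<notin> A"
    and K: "K \<subseteq> U" "u \<in> K" and s: "splits A I A' J" "A' \<subseteq> A" "I \<subseteq> U" "u \<in> I" "\<not> K \<subseteq> I"
  shows "J(a := K) \<in> dragons (insert a A) U"
proof -
  have JU: "J i \<subseteq> U" if "i \<in> A" for i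
    using PiE_mem[OF J that] by simp
  have fJ: "finite (\<Union>i\<in>S. J i)" if "S \<subseteq> A" for S
    using that JU by (intro finite_subset[OF _ fin(2)]) auto
  have finK: "finite K" and finI: "finite I" using K s fin finite_subset by blast+
  have sI: "\<And>i. i \<in> A' \<Longrightarrow> J i \<subseteq> I"
    and s1: "\<And>T. T \<subseteq> A' \<Longrightarrow> T \<noteq> {} \<Longrightarrow> card T < card (\<Union>i\<in>T. J i)"
    and s2: "\<And>T. T \<subseteq> A - A' \<Longrightarrow> T \<noteq> {} \<Longrightarrow> card T < card (\<Union>i\<in>T. J i - I)"
    using s unfolding splits_def by auto
  have fJI: "finite (\<Union>i\<in>T. J i - I)" if "T \<subseteq> A" for T
    by (rule finite_subset[OF _ fJ[OF that]]) auto
  have cS: "card S = card (S \<inter> A') + card (S - A')" if "S \<subseteq> A" for S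
    using that fin(1) finite_subset card_Int_Diff by metis
  have sub: "S - A' \<subseteq> A - A'" if "S \<subseteq> A" for S using that by auto
  have d1: "card S < card (\<Union>i\<in>S. J i)" if S: "S \<subseteq> A" "S \<noteq> {}" for S
  proof -
    let ?N1 = "\<Union>i\<in>S \<inter> A'. J i" and ?N2 = "\<Union>i\<in>S - A'. J i - I"
    have "card (S \<inter> A') \<le> card ?N1"
      using s1[of "S \<inter> A'"] by (cases "S \<inter> A' = {}") auto
    moreover have "card (S - A') \<le> card ?N2"
      using s2[OF sub[OF S(1)]] by (metis card.empty less_imp_le_nat zero_le)
    moreover have "card (S \<inter> A') < card ?N1 \<or> card (S - A') < card ?N2"
      using s1[of "S \<inter> A'"] s2[OF sub[OF S(1)]] S(2) by blast
    moreover have "card (?N1 \<union> ?N2) = card ?N1 + card ?N2"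
      using sI fJ[of "S \<inter> A'"] fJI[of "S - A'"] S by (intro card_Un_disjoint) auto
    moreover have "card (?N1 \<union> ?N2) \<le> card (\<Union>i\<in>S. J i)"
      using fJ[OF S(1)] by (intro card_mono) auto
    ultimately show ?thesis using cS[OF S(1)] by linarith
  qed
  have d2: "Suc (card S) < card (K \<union> (\<Union>i\<in>S. J i))" if S: "S \<subseteq> A" for S
  proof -
    let ?N1 = "insert u (\<Union>i\<in>S \<inter> A'. J i)" and ?N2 = "(K - I) \<union> (\<Union>i\<in>S - A'. J i - I)"
    have f1: "finite ?N1" and f2: "finite ?N2"
      using fJ[of "S \<inter> A'"] fJI[of "S - A'"] S finK by auto
    have "Suc (card (S \<inter> A')) \<le> card ?N1"
    proof (cases "S \<inter> A' = {}")
      case False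
      have "card (\<Union>i\<in>S \<inter> A'. J i) \<le> card ?N1" using f1 by (intro card_mono) auto
      thus ?thesis using s1[of "S \<inter> A'"] False by auto
    qed auto
    moreover have "Suc (card (S - A')) \<le> card ?N2"
    proof (cases "S - A' = {}")
      case True
      have "K - I \<noteq> {}" using s by auto
      hence "card (K - I) \<noteq> 0" using finK by simp
      thus ?thesis unfolding True by simp
    next
      case False
      have "card (\<Union>i\<in>S - A'. J i - I) \<le> card ?N2" using f2 by (intro card_mono) auto
      thus ?thesis using s2[OF sub[OF S] False] by linarith
    qed
    moreover have "card (?N1 \<union> ?N2) = card ?N1 + card ?N2"
      using f1 f2 sI s by (intro card_Un_disjoint) auto
    moreover have "card (?N1 \<union> ?N2) \<le> card (K \<union> (\<Union>i\<in>S. J i))"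
      using fJ[OF S] finK K by (intro card_mono) auto
    ultimately show ?thesis using cS[OF S] by linarith
  qed
  have "card T < card (\<Union>i\<in>T. (J(a := K)) i)" if T: "T \<subseteq> insert a A" "T \<noteq> {}" for T
  proof -
    have TA: "T - {a} \<subseteq> A" using T by auto
    have eq: "(\<Union>i\<in>T - {a}. (J(a := K)) i) = (\<Union>i\<in>T - {a}. J i)"
      by (intro SUP_cong) auto
    show ?thesis
    proof (cases "a \<in> T")
      case True
      have "finite T" using T fin finite_subset by auto
      hence "card T = Suc (card (T - {a}))" using True by (rule card.remove)
      moreover have "(\<Union>i\<in>T. (J(a := K)) i) = K \<union> (\<Union>i\<in>T - {a}. (J(a := K)) i)"
        by (metis True UN_insert fun_upd_same insert_Diff)
      ultimately show ?thesis using d2[OF TA] eq by simp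
    next
      case False
      thus ?thesis using d1[OF TA] eq T by simp
    qed
  qed
  moreover have "J(a := K) \<in> insert a A \<rightarrow>\<^sub>E Pow U"
    using fun_upd_in_PiE[of a A _ "\<lambda>_. Pow U"] J K JU a by (intro PiE_I) (auto dest: PiE_arb)
  ultimately show ?thesis unfolding dragons_def by auto
qed

text \<open>Double counting of pairs of a collection and an admissible splitting: a collection that
  \<open>K\<close> completes to a dragon collection has exactly one splitting, every other
  collection has none.\<close>

lemma dragons_fixed_sum:
  assumes fin: "finite A" "finite U" and a: "a \<notin> A" and K: "K \<subseteq> U" "u \<in> K"
  shows "(\<Sum>J | J \<in> A \<rightarrow>\<^sub>E Pow U \<and> J(a := K) \<in> dragons (insert a A) U. \<Prod>i\<in>A. w (card (J i)))
    = (\<Sum>I | I \<in> Pow U \<and> u \<in> I \<and> \<not> K \<subseteq> I. \<Sum>A' | A' \<in> Pow A \<and> card I = Suc (card A').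
        dragon_sum A' I w * dragon_sum (A - A') (U - I) (\<lambda>k. \<Sum>M\<in>Pow I. w (k + card M)))"
proof -
  let ?X = "A \<rightarrow>\<^sub>E Pow U" and ?p = "\<lambda>J. \<Prod>i\<in>A. w (card (J i))"
  let ?R = "Sigma {I. I \<in> Pow U \<and> u \<in> I \<and> \<not> K \<subseteq> I} (\<lambda>I. {A'. A' \<in> Pow A \<and> card I = Suc (card A')})"
  have finX: "finite ?X" using fin by (intro finite_PiE) auto
  have finR: "finite ?R" using fin by (intro finite_SigmaI) auto
  have count: "(\<Sum>(I, A')\<in>?R. if splits A I A' J then ?p J else 0)
      = (if J(a := K) \<in> dragons (insert a A) U then ?p J else 0)" if J: "J \<in> ?X" for J
  proof (cases "J(a := K) \<in> dragons (insert a A) U")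
    case True
    then obtain I A' where IA: "(I, A') \<in> ?R" "splits A I A' J"
      using splits_exists[OF fin J a K] by auto
    have "I2 = I \<and> A2 = A'" if "(I2, A2) \<in> ?R" "splits A I2 A2 J" for I2 A2
    proof -
      have h: "A' \<subseteq> A" "I \<subseteq> U" "u \<in> I" "card I = Suc (card A')"
        "A2 \<subseteq> A" "I2 \<subseteq> U" "u \<in> I2" "card I2 = Suc (card A2)"
        using IA that by auto
      note e = splits_determined[OF fin J IA(2) h(1-4)] splits_determined[OF fin J that(2) h(5-8)]
      have "A2 \<subseteq> A'" using e(2)[OF h(5)] e(3) h(8) by simp
      moreover have "A' \<subseteq> A2" using e(4)[OF h(1)] e(1) h(4) by simp
      ultimately show ?thesis using e(1,3) by simp
    qed
    hence iff: "splits A I2 A2 J \<longleftrightarrow> (I2, A2) = (I, A')" if "(I2, A2) \<in> ?R" for I2 A2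
      using that IA(2) by blast
    have "(case r of (I, A') \<Rightarrow> if splits A I A' J then ?p J else 0) = (if r = (I, A') then ?p J else 0)"
      if "r \<in> ?R" for r
    proof (cases r)
      case (Pair I2 A2)
      thus ?thesis using iff[of I2 A2] that by (simp only: prod.case)
    qed
    hence "(\<Sum>(I, A')\<in>?R. if splits A I A' J then ?p J else 0)
        = (\<Sum>r\<in>?R. if r = (I, A') then ?p J else 0)"
      by (rule sum.cong[OF refl])
    also have "\<dots> = ?p J"
      using IA(1) finR by (subst sum.delta) auto
    finally show ?thesis using True by simp
  next
    case False
    have "\<not> splits A I A' J" if "(I, A') \<in> ?R" for I A'
      using splits_dragon[OF fin J a K, of I A'] that False by auto
    hence "(\<Sum>(I, A')\<in>?R. if splits A I A' J then ?p J else 0) = 0"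
      by (intro sum.neutral) auto
    thus ?thesis using False by simp
  qed
  have "(\<Sum>J | J \<in> ?X \<and> J(a := K) \<in> dragons (insert a A) U. ?p J)
      = (\<Sum>J\<in>?X. if J(a := K) \<in> dragons (insert a A) U then ?p J else 0)"
    using finX by (simp add: sum.If_cases Int_def)
  also have "\<dots> = (\<Sum>J\<in>?X. \<Sum>(I, A')\<in>?R. if splits A I A' J then ?p J else 0)"
    using count by (intro sum.cong) auto
  also have "\<dots> = (\<Sum>(I, A')\<in>?R. \<Sum>J\<in>?X. if splits A I A' J then ?p J else 0)"
    by (subst sum.swap) (simp add: case_prod_unfold)
  also have "\<dots> = (\<Sum>(I, A')\<in>?R. \<Sum>J | J \<in> ?X \<and> splits A I A' J. ?p J)"
    using finX by (simp add: sum.If_cases Int_def)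
  also have "\<dots> = (\<Sum>(I, A')\<in>?R.
      dragon_sum A' I w * dragon_sum (A - A') (U - I) (\<lambda>k. \<Sum>M\<in>Pow I. w (k + card M)))"
    using splits_sum[OF fin] by (intro sum.cong) auto
  also have "\<dots> = (\<Sum>I | I \<in> Pow U \<and> u \<in> I \<and> \<not> K \<subseteq> I. \<Sum>A' | A' \<in> Pow A \<and> card I = Suc (card A').
        dragon_sum A' I w * dragon_sum (A - A') (U - I) (\<lambda>k. \<Sum>M\<in>Pow I. w (k + card M)))"
    using fin by (intro sum.Sigma[symmetric]) auto
  finally show ?thesis .
qed

section \<open>The volume polynomial and its gradient\<close>

lemma sum_Pow_card:
  fixes f :: "nat \<Rightarrow> real"
  assumes "finite U"
  shows "(\<Sum>I\<in>Pow U. f (card I)) = (\<Sum>k\<le>card U. real (card U choose k) * f k)"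
proof -
  have "(\<Sum>I\<in>Pow U. f (card I)) = (\<Sum>k\<le>card U. \<Sum>I | I \<in> Pow U \<and> card I = k. f (card I))"
    using assms by (intro sum.group[symmetric]) (auto intro: card_mono)
  also have "\<dots> = (\<Sum>k\<le>card U. real (card U choose k) * f k)"
    using assms by (intro sum.cong) (auto simp: n_subsets)
  finally show ?thesis .
qed

text \<open>A proportion \<open>k / card U\<close> of the \<open>k\<close>-subsets contains a given
  element. This ratio is the origin of the term \<open>k / n\<close> times the total sum in the
  gradient formula.\<close>

lemma sum_Pow_mem_card:
  fixes f :: "nat \<Rightarrow> real"
  assumes "finite U" "u \<in> U"
  shows "(\<Sum>I | I \<in> Pow U \<and> u \<in> I. f (card I)) = (\<Sum>k\<le>card U. real k / card U * real (card U choose k) * f k)"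
proof -
  obtain m where m: "card U = Suc m" and cm: "card (U - {u}) = m"
    using assms by (cases "card U") auto
  have "I \<in> insert u ` Pow (U - {u})" if "I \<subseteq> U" "u \<in> I" for I
    using that by (intro image_eqI[of _ _ "I - {u}"]) auto
  hence "{I. I \<in> Pow U \<and> u \<in> I} = insert u ` Pow (U - {u})"
    using assms by auto
  hence "(\<Sum>I | I \<in> Pow U \<and> u \<in> I. f (card I)) = (\<Sum>I\<in>Pow (U - {u}). f (Suc (card I)))"
    using sum_Pow_insert_image[of "U - {u}" u f] assms by simp
  also have "\<dots> = (\<Sum>k\<le>m. real (m choose k) * f (Suc k))"
    using sum_Pow_card[of "U - {u}" "\<lambda>k. f (Suc k)"] assms cm by simp
  also have "\<dots> = (\<Sum>k\<le>m. real (Suc k) / Suc m * real (Suc m choose Suc k) * f (Suc k))"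
  proof (rule sum.cong[OF refl])
    fix k
    have "real (Suc k) * real (Suc m choose Suc k) = real (Suc m) * real (m choose k)"
      by (metis Suc_times_binomial_eq mult.commute of_nat_mult)
    thus "real (m choose k) * f (Suc k) = real (Suc k) / Suc m * real (Suc m choose Suc k) * f (Suc k)"
      by (simp add: field_simps)
  qed
  also have "\<dots> = (\<Sum>k\<le>Suc m. real k / Suc m * real (Suc m choose k) * f k)"
    by (subst sum.atMost_Suc_shift) simp
  finally show ?thesis by (simp add: m)
qed

section \<open>Invariance of dragon sums under relabelling\<close>

lemma dragon_sum_cong:
  assumes "finite U" and "\<And>k. k \<in> {2..card U} \<Longrightarrow> w k = w' k"
  shows "dragon_sum A U w = dragon_sum A U w'"
  unfolding dragon_sum_def
proof (intro sum.cong prod.cong refl)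
  fix J i assume J: "J \<in> dragons A U" "i \<in> A"
  hence "J i \<subseteq> U" by (auto simp: dragons_def)
  hence "card (J i) \<le> card U" using assms(1) card_mono by blast
  thus "w (card (J i)) = w' (card (J i))"
    using dragons_card[OF J] assms(2) by simp
qed

lemma dragons_subset: "J \<in> dragons A U \<Longrightarrow> i \<in> A \<Longrightarrow> J i \<subseteq> U"
  by (auto simp: dragons_def)

lemma dragons_undefined: "J \<in> dragons A U \<Longrightarrow> i \<notin> A \<Longrightarrow> J i = undefined"
  by (auto simp: dragons_def dest: PiE_arb)

lemma dragons_image:
  assumes J: "J \<in> dragons B V" and e: "bij_betw e B' B" and h: "bij_betw h V V'"
  shows "restrict (\<lambda>i. h ` J (e i)) B' \<in> dragons B' V'"
proof -
  have JB: "J i \<subseteq> V" if "i \<in> B" for i using J that by (auto simp: dragons_def)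
  have eB: "e i \<in> B" if "i \<in> B'" for i using e that by (rule bij_betw_apply)
  have "h ` J (e i) \<in> Pow V'" if "i \<in> B'" for i
    using bij_betw_imp_surj_on[OF h] JB[OF eB[OF that]] by blast
  hence "restrict (\<lambda>i. h ` J (e i)) B' \<in> B' \<rightarrow>\<^sub>E Pow V'" by auto
  moreover have "card I < card (\<Union>i\<in>I. restrict (\<lambda>i. h ` J (e i)) B' i)" if I: "I \<subseteq> B'" "I \<noteq> {}" for I
  proof -
    have "(\<Union>i\<in>I. restrict (\<lambda>i. h ` J (e i)) B' i) = (\<Union>i\<in>I. h ` J (e i))"
      using I by (intro SUP_cong) auto
    also have "\<dots> = h ` (\<Union>i\<in>e ` I. J i)" by auto
    also have "card \<dots> = card (\<Union>i\<in>e ` I. J i)"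
    proof (rule card_image)
      have "(\<Union>i\<in>e ` I. J i) \<subseteq> V" using JB eB I by blast
      thus "inj_on h (\<Union>i\<in>e ` I. J i)"
        using h unfolding bij_betw_def by (metis inj_on_subset)
    qed
    also have "card (e ` I) < \<dots>"
    proof -
      have "e ` I \<subseteq> B" "e ` I \<noteq> {}" using I eB by auto
      moreover have "\<forall>S\<subseteq>B. S \<noteq> {} \<longrightarrow> card S < card (\<Union>i\<in>S. J i)"
        using J unfolding dragons_def by simp
      ultimately show ?thesis by (elim allE impE)
    qed
    also have "card (e ` I) = card I"
      using e I unfolding bij_betw_def by (meson card_image inj_on_subset)
    finally show ?thesis .
  qed
  ultimately show ?thesis unfolding dragons_def by blast
qed

text \<open>Makes the sum depend only on the sizes of \<open>A\<close> and \<open>U\<close>, so that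
  the factors belonging to a facet, which live on arbitrary subsets, can be identified with the
  polynomials on initial segments.\<close>

lemma dragon_sum_bij:
  assumes f: "bij_betw f A A'" and g: "bij_betw g U U'"
  shows "dragon_sum A U w = dragon_sum A' U' w"
proof -
  define f' where "f' = inv_into A f"
  define g' where "g' = inv_into U g"
  have f': "bij_betw f' A' A" "\<And>i. i \<in> A \<Longrightarrow> f' (f i) = i" "\<And>i. i \<in> A' \<Longrightarrow> f (f' i) = i"
    using f by (auto simp: f'_def bij_betw_inv_into bij_betw_inv_into_left bij_betw_inv_into_right)
  have g': "bij_betw g' U' U" "\<And>i. i \<in> U \<Longrightarrow> g' (g i) = i" "\<And>i. i \<in> U' \<Longrightarrow> g (g' i) = i"
    using g by (auto simp: g'_def bij_betw_inv_into bij_betw_inv_into_left bij_betw_inv_into_right)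
  have gg: "g' ` g ` S = S" if "S \<subseteq> U" for S
    using that g'(2) by (force simp: image_iff)
  have gg': "g ` g' ` S = S" if "S \<subseteq> U'" for S
    using that g'(3) by (force simp: image_iff)
  have fA: "f i \<in> A'" if "i \<in> A" for i using f that by (rule bij_betw_apply)
  have fA': "f' i \<in> A" if "i \<in> A'" for i using f'(1) that by (rule bij_betw_apply)
  show ?thesis
    unfolding dragon_sum_def
  proof (rule sum.reindex_bij_witness[where
        i = "\<lambda>J. restrict (\<lambda>i. g' ` J (f i)) A" and j = "\<lambda>J. restrict (\<lambda>i. g ` J (f' i)) A'"], goal_cases)
    case (1 J)
    show ?case
      using gg dragons_subset[OF 1] dragons_undefined[OF 1] fA f'(2) by (auto simp: fun_eq_iff restrict_def)
  next
    case (2 J) show ?case using dragons_image[OF 2 f'(1) g] .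
  next
    case (3 J)
    show ?case
      using gg' dragons_subset[OF 3] dragons_undefined[OF 3] fA' f'(3) by (auto simp: fun_eq_iff restrict_def)
  next
    case (4 J) show ?case using dragons_image[OF 4 f g'(1)] .
  next
    case (5 J)
    have "card (g ` J i) = card (J i)" if "i \<in> A" for i
      using dragons_subset[OF 5 that] g unfolding bij_betw_def by (meson card_image inj_on_subset)
    hence "(\<Prod>i\<in>A. w (card (J i))) = (\<Prod>i\<in>A. w (card (restrict (\<lambda>i. g ` J (f' i)) A' (f i))))"
      using fA f'(2) by (intro prod.cong) auto
    thus ?case using prod.reindex_bij_betw[OF f, of "\<lambda>i. w (card (restrict (\<lambda>i. g ` J (f' i)) A' i))"]
      by simp
  qed
qed

section \<open>The polynomial, its directional derivative and Euler's relation\<close>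

definition perm_poly :: "nat \<Rightarrow> (nat \<Rightarrow> real) \<Rightarrow> real" where
  "perm_poly n x = dragon_sum {1..<n} {1..n} (\<lambda>k. neg_diff k x) / fact (n - 1)"

text \<open>Product rule, using that \<open>neg_diff\<close> is linear in the sequence. The
  direction \<open>d\<close> is an argument because three choices occur: the sequence itself
  (Euler's relation), the merged sequence, and minus a unit vector (varying the slice).\<close>

definition perm_poly_deriv :: "nat \<Rightarrow> (nat \<Rightarrow> real) \<Rightarrow> (nat \<Rightarrow> real) \<Rightarrow> real" where
  "perm_poly_deriv n x d = (\<Sum>J\<in>dragons {1..<n} {1..n}. \<Sum>i\<in>{1..<n}.
      neg_diff (card (J i)) d * (\<Prod>j\<in>{1..<n} - {i}. neg_diff (card (J j)) x)) / fact (n - 1)"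

lemma neg_diff_cong:
  assumes "1 \<le> k" "\<And>j. j \<in> {1..k} \<Longrightarrow> x j = x' j"
  shows "neg_diff k x = neg_diff k x'"
  unfolding neg_diff_def using assms by (intro arg_cong[of _ _ uminus] sum.cong) auto

lemma perm_poly_cong:
  assumes "\<And>j. j \<in> {1..n} \<Longrightarrow> x j = x' j"
  shows "perm_poly n x = perm_poly n x'"
proof -
  have "dragon_sum {1..<n} {1..n} (\<lambda>k. neg_diff k x) = dragon_sum {1..<n} {1..n} (\<lambda>k. neg_diff k x')"
    by (intro dragon_sum_cong neg_diff_cong assms) auto
  thus ?thesis by (simp add: perm_poly_def)
qed

lemma perm_poly_1 [simp]: "perm_poly (Suc 0) x = 1"
  by (simp add: perm_poly_def dragon_sum_def dragons_def PiE_empty_domain)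

lemma dragon_sum_eq_perm_poly:
  fixes A :: "'i set" and U :: "'e set"
  assumes "finite A" "finite U" "card U = Suc (card A)"
  shows "dragon_sum A U (\<lambda>k. neg_diff k x) = fact (card A) * perm_poly (Suc (card A)) x"
proof -
  obtain f where f: "bij_betw f A {1..<Suc (card A)}"
    using finite_same_card_bij[of A "{1..<Suc (card A)}"] assms by auto
  obtain g where g: "bij_betw g U {1..Suc (card A)}"
    using finite_same_card_bij[of U "{1..Suc (card A)}"] assms by auto
  show ?thesis
    using dragon_sum_bij[OF f g] by (simp add: perm_poly_def)
qed

lemma has_real_derivative_neg_diff:
  assumes "k \<ge> 1" "\<And>j. j \<in> {1..k} \<Longrightarrow> ((\<lambda>s. X s j) has_real_derivative d j) (at s)"
  shows "((\<lambda>s. neg_diff k (X s)) has_real_derivative neg_diff k d) (at s)"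
  unfolding neg_diff_def using assms
  by (intro DERIV_minus DERIV_sum DERIV_cmult) auto

lemma has_real_derivative_perm_poly:
  assumes "\<And>j. j \<in> {1..n} \<Longrightarrow> ((\<lambda>s. X s j) has_real_derivative d j) (at s)"
  shows "((\<lambda>s. perm_poly n (X s)) has_real_derivative perm_poly_deriv n (X s) d) (at s)"
proof -
  let ?D = "dragons {1..<n} {1..n}"
  have nd: "((\<lambda>s. neg_diff (card (J i)) (X s)) has_real_derivative neg_diff (card (J i)) d) (at s)"
    if J: "J \<in> ?D" "i \<in> {1..<n}" for J i
  proof (rule has_real_derivative_neg_diff)
    show "1 \<le> card (J i)"
      using dragons_card[OF J] by simp
    have "card (J i) \<le> n"
      using card_mono[OF _ dragons_subset[OF J]] by simp
    thus "((\<lambda>s. X s j) has_real_derivative d j) (at s)" if "j \<in> {1..card (J i)}" for j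
      using that assms[of j] by simp
  qed
  have "((\<lambda>s. \<Prod>i\<in>{1..<n}. neg_diff (card (J i)) (X s)) has_real_derivative
      (\<Sum>i\<in>{1..<n}. neg_diff (card (J i)) d * (\<Prod>j\<in>{1..<n} - {i}. neg_diff (card (J j)) (X s)))) (at s)"
    if J: "J \<in> ?D" for J
    using nd[OF J] by (rule has_field_derivative_prod)
  hence "((\<lambda>s. \<Sum>J\<in>dragons {1..<n} {1..n}. \<Prod>i\<in>{1..<n}. neg_diff (card (J i)) (X s)) has_real_derivative
      (\<Sum>J\<in>dragons {1..<n} {1..n}. \<Sum>i\<in>{1..<n}.
        neg_diff (card (J i)) d * (\<Prod>j\<in>{1..<n} - {i}. neg_diff (card (J j)) (X s)))) (at s)"
    by (rule DERIV_sum)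
  thus ?thesis
    unfolding perm_poly_def perm_poly_deriv_def dragon_sum_def by (rule DERIV_cdivide)
qed

lemma perm_poly_deriv_self:
  "perm_poly_deriv n x x = real (n - 1) * perm_poly n x"
proof -
  have "(\<Sum>i\<in>{1..<n}. f i * (\<Prod>j\<in>{1..<n} - {i}. f j)) = real (n - 1) * (\<Prod>i\<in>{1..<n}. f i)" for f :: "nat \<Rightarrow> real"
  proof -
    have "(\<Sum>i\<in>{1..<n}. f i * (\<Prod>j\<in>{1..<n} - {i}. f j)) = (\<Sum>i\<in>{1..<n}. \<Prod>j\<in>{1..<n}. f j)"
      by (intro sum.cong) (auto simp: prod.remove)
    thus ?thesis by simp
  qed
  thus ?thesis
    by (simp add: perm_poly_def perm_poly_deriv_def dragon_sum_def sum_distrib_left)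
qed

section \<open>The gradient as a sum over facets\<close>

lemma dragons_insert_sum:
  fixes v w :: "nat \<Rightarrow> real"
  assumes fin: "finite A" "finite U" and a: "a \<notin> A"
  shows "(\<Sum>J\<in>dragons (insert a A) U. v (card (J a)) * (\<Prod>i\<in>A. w (card (J i))))
    = (\<Sum>K\<in>Pow U - {{}}. v (card K) *
        (\<Sum>J | J \<in> A \<rightarrow>\<^sub>E Pow U \<and> J(a := K) \<in> dragons (insert a A) U. \<Prod>i\<in>A. w (card (J i))))"
proof -
  let ?S = "\<lambda>K. {J. J \<in> A \<rightarrow>\<^sub>E Pow U \<and> J(a := K) \<in> dragons (insert a A) U}"
  have finS: "finite (?S K)" for K
    by (rule finite_subset[of _ "A \<rightarrow>\<^sub>E Pow U"]) (use fin in \<open>auto intro: finite_PiE\<close>)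
  have "(\<Sum>J\<in>dragons (insert a A) U. v (card (J a)) * (\<Prod>i\<in>A. w (card (J i))))
    = (\<Sum>(K, J)\<in>Sigma (Pow U - {{}}) ?S. v (card K) * (\<Prod>i\<in>A. w (card (J i))))"
  proof (rule sum.reindex_bij_witness[where i = "\<lambda>(K, J). J(a := K)" and j = "\<lambda>J. (J a, restrict J A)"], goal_cases)
    case (1 J)
    have "J i = undefined" if "i \<notin> insert a A" for i
      using 1 that by (auto simp: dragons_def dest: PiE_arb)
    thus ?case by (auto simp: fun_eq_iff)
  next
    case (2 J)
    have "(restrict J A)(a := J a) = J"
    proof
      fix i show "((restrict J A)(a := J a)) i = J i"
        using 2 by (cases "i \<in> insert a A") (auto simp: dragons_def dest: PiE_arb)
    qed
    moreover have "J a \<in> Pow U - {{}}"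
      using dragons_card[OF 2, of a] 2 by (auto simp: dragons_def)
    moreover have "restrict J A \<in> A \<rightarrow>\<^sub>E Pow U"
      using 2 by (auto simp: dragons_def)
    ultimately show ?case using 2 by simp
  next
    case (3 r)
    obtain K J where r: "r = (K, J)" by (cases r)
    have J: "J \<in> A \<rightarrow>\<^sub>E Pow U" using 3 r by simp
    have "restrict (J(a := K)) A = J"
    proof
      fix i show "restrict (J(a := K)) A i = J i"
        using a PiE_arb[OF J, of i] by auto
    qed
    thus ?case by (simp add: r)
  next
    case (4 r)
    thus ?case by auto
  next
    case (5 J)
    thus ?case by simp
  qed
  also have "\<dots> = (\<Sum>K\<in>Pow U - {{}}. v (card K) * (\<Sum>J\<in>?S K. \<Prod>i\<in>A. w (card (J i))))"
    using fin finS by (subst sum.Sigma[symmetric]) (auto simp: sum_distrib_left)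
  finally show ?thesis by simp
qed

lemma dragon_sum_contract:
  assumes "finite B" "finite V" "card V = Suc (card B)" "finite I"
  shows "dragon_sum B V (\<lambda>k. \<Sum>M\<in>Pow I. neg_diff (k + card M) x)
       = fact (card B) * perm_poly (Suc (card B)) (shift (card I) x)"
proof -
  have "dragon_sum B V (\<lambda>k. \<Sum>M\<in>Pow I. neg_diff (k + card M) x)
      = dragon_sum B V (\<lambda>k. neg_diff k (shift (card I) x))"
    using assms by (intro dragon_sum_cong neg_diff_sum_Pow) auto
  thus ?thesis using dragon_sum_eq_perm_poly[OF assms(1-3)] by simp
qed

text \<open>Each summand depends on \<open>A'\<close> only through its size, and the number
  \<open>card A choose (card I - 1)\<close> of choices cancels the factorials of the two factors up
  to \<open>fact (card A)\<close>. A facet thus becomes a plain product of two polynomials.\<close>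

lemma dragon_sum_splits:
  assumes fin: "finite A" "finite U" and c: "card U = card A + 2"
    and I: "I \<subseteq> U" "I \<noteq> {}" "I \<noteq> U"
  shows "(\<Sum>A' | A' \<in> Pow A \<and> card I = Suc (card A').
            dragon_sum A' I (\<lambda>k. neg_diff k x)
            * dragon_sum (A - A') (U - I) (\<lambda>k. \<Sum>M\<in>Pow I. neg_diff (k + card M) x))
       = fact (card A) * (perm_poly (card I) x * perm_poly (card U - card I) (shift (card I) x))"
proof -
  have finI: "finite I" using I fin finite_subset by blast
  have cI: "0 < card I" "card I < card U"
    using I fin finI psubset_card_mono[of U I] by (auto simp: card_gt_0_iff)
  have "dragon_sum A' I (\<lambda>k. neg_diff k x)
        * dragon_sum (A - A') (U - I) (\<lambda>k. \<Sum>M\<in>Pow I. neg_diff (k + card M) x)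
      = fact (card I - 1) * fact (card A - (card I - 1))
        * (perm_poly (card I) x * perm_poly (card U - card I) (shift (card I) x))"
    if A': "A' \<subseteq> A" "card I = Suc (card A')" for A'
  proof -
    have "finite A'" using A' fin finite_subset by blast
    moreover have "card (A - A') = card A - card A'"
      using A' \<open>finite A'\<close> by (simp add: card_Diff_subset)
    moreover have "card (U - I) = card U - card I"
      using I finI by (simp add: card_Diff_subset)
    moreover have "card A' \<le> card A"
      using A' fin by (simp add: card_mono)
    ultimately show ?thesis
      using dragon_sum_eq_perm_poly[of A' I x] dragon_sum_contract[of "A - A'" "U - I" I x] A' fin finI c cI
      by (simp add: Suc_diff_le)
  qed
  hence "(\<Sum>A' | A' \<in> Pow A \<and> card I = Suc (card A').
            dragon_sum A' I (\<lambda>k. neg_diff k x)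
            * dragon_sum (A - A') (U - I) (\<lambda>k. \<Sum>M\<in>Pow I. neg_diff (k + card M) x))
      = real (card {A'. A' \<subseteq> A \<and> card A' = card I - 1}) * (fact (card I - 1) * fact (card A - (card I - 1))
        * (perm_poly (card I) x * perm_poly (card U - card I) (shift (card I) x)))"
    (is "_ = _ * ?c")
  proof -
    assume *: "\<And>A'. A' \<subseteq> A \<Longrightarrow> card I = Suc (card A') \<Longrightarrow>
        dragon_sum A' I (\<lambda>k. neg_diff k x)
        * dragon_sum (A - A') (U - I) (\<lambda>k. \<Sum>M\<in>Pow I. neg_diff (k + card M) x) = ?c"
    have "{A'. A' \<in> Pow A \<and> card I = Suc (card A')} = {A'. A' \<subseteq> A \<and> card A' = card I - 1}"
      using cI by auto
    moreover have "(\<Sum>A' | A' \<in> Pow A \<and> card I = Suc (card A').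
            dragon_sum A' I (\<lambda>k. neg_diff k x)
            * dragon_sum (A - A') (U - I) (\<lambda>k. \<Sum>M\<in>Pow I. neg_diff (k + card M) x))
        = (\<Sum>A' | A' \<in> Pow A \<and> card I = Suc (card A'). ?c)"
      using * by (intro sum.cong) auto
    ultimately show ?thesis by simp
  qed
  also have "\<dots> = real (card A choose (card I - 1)) * (fact (card I - 1) * fact (card A - (card I - 1))
        * (perm_poly (card I) x * perm_poly (card U - card I) (shift (card I) x)))"
    using fin by (simp add: n_subsets)
  also have "real (card A choose (card I - 1)) * (fact (card I - 1) * fact (card A - (card I - 1))
        * (perm_poly (card I) x * perm_poly (card U - card I) (shift (card I) x)))
      = fact (card A) * (perm_poly (card I) x * perm_poly (card U - card I) (shift (card I) x))"
  proof -
    have "fact (card I - 1) * fact (card A - (card I - 1)) * (card A choose (card I - 1)) = fact (card A)"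
      using cI c by (intro binomial_fact_lemma) linarith
    hence "(fact (card I - 1) * fact (card A - (card I - 1)) * real (card A choose (card I - 1)) :: real) = fact (card A)"
      by (metis of_nat_fact of_nat_mult)
    from this[symmetric] show ?thesis by (simp only: mult_ac)
  qed
  finally show ?thesis .
qed

text \<open>The choice of \<open>u \<in> K\<close> is immaterial, since \<open>f\<close> depends on cardinalities only.\<close>

lemma sum_Pow_not_superset:
  fixes f :: "nat \<Rightarrow> real" and d :: "nat \<Rightarrow> real"
  assumes U: "finite U" "U \<noteq> {}"
  shows "(\<Sum>K\<in>Pow U - {{}}. neg_diff (card K) d *
           (\<Sum>I | I \<in> Pow U \<and> (SOME u. u \<in> K) \<in> I \<and> \<not> K \<subseteq> I. f (card I)))
       = (\<Sum>k\<in>{1..<card U}. real (card U choose k) * f k *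
           ((\<Sum>j=1..k. d j) - real k / card U * (\<Sum>j=1..card U. d j)))"
proof -
  let ?n = "card U"
  define C where "C = (\<Sum>k\<le>?n. real k / ?n * real (?n choose k) * f k)"
  have D: "- D ?n * C - (\<Sum>k\<le>?n. real (?n choose k) * (- D k * f k))
      = (\<Sum>k\<le>?n. real (?n choose k) * f k * (D k - real k / ?n * D ?n))" for D :: "nat \<Rightarrow> real"
    unfolding C_def sum_distrib_left sum_subtractf[symmetric]
    by (rule sum.cong) (simp_all add: algebra_simps)
  have "(\<Sum>I | I \<in> Pow U \<and> (SOME u. u \<in> K) \<in> I \<and> \<not> K \<subseteq> I. f (card I))
      = C - (\<Sum>I | I \<in> Pow U \<and> K \<subseteq> I. f (card I))" if K: "K \<in> Pow U - {{}}" for K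
  proof -
    define u where "u = (SOME u. u \<in> K)"
    have u: "u \<in> K" unfolding u_def using K by (intro some_in_eq[THEN iffD2]) auto
    \<comment> \<open>As \<open>u \<in> K\<close>, the supersets of \<open>K\<close> form a
      subfamily of the sets containing \<open>u\<close>; removing them leaves a complement that no
      longer involves the position of \<open>u\<close>.\<close>
    have "{I. I \<in> Pow U \<and> u \<in> I} = {I. I \<in> Pow U \<and> u \<in> I \<and> \<not> K \<subseteq> I} \<union> {I. I \<in> Pow U \<and> K \<subseteq> I}"
      using u by auto
    hence "(\<Sum>I | I \<in> Pow U \<and> u \<in> I. f (card I))
        = (\<Sum>I | I \<in> Pow U \<and> u \<in> I \<and> \<not> K \<subseteq> I. f (card I)) + (\<Sum>I | I \<in> Pow U \<and> K \<subseteq> I. f (card I))"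
      using U by (simp only:) (intro sum.union_disjoint, auto)
    moreover have "u \<in> U" using u K by auto
    ultimately show ?thesis
      using sum_Pow_mem_card[OF U(1), of u f] by (simp add: C_def flip: u_def)
  qed
  hence "(\<Sum>K\<in>Pow U - {{}}. neg_diff (card K) d *
           (\<Sum>I | I \<in> Pow U \<and> (SOME u. u \<in> K) \<in> I \<and> \<not> K \<subseteq> I. f (card I)))
       = (\<Sum>K\<in>Pow U - {{}}. neg_diff (card K) d * C
           - neg_diff (card K) d * (\<Sum>I | I \<in> Pow U \<and> K \<subseteq> I. f (card I)))"
    by (intro sum.cong) (auto simp: right_diff_distrib)
  also have "\<dots> = - (\<Sum>j=1..?n. d j) * C
      - (\<Sum>K\<in>Pow U - {{}}. \<Sum>I | I \<in> Pow U \<and> K \<subseteq> I. neg_diff (card K) d * f (card I))"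
    using neg_diff_sum_nonempty[OF U(1), of d]
    by (simp add: sum_subtractf sum_distrib_left flip: sum_distrib_right)
  \<comment> \<open>After the exchange the inner sum runs over the nonempty subsets of
    \<open>I\<close>, whose weights add up to minus a partial sum of \<open>d\<close>.\<close>
  also have "(\<Sum>K\<in>Pow U - {{}}. \<Sum>I | I \<in> Pow U \<and> K \<subseteq> I. neg_diff (card K) d * f (card I))
      = (\<Sum>I\<in>Pow U. \<Sum>K | K \<in> Pow U - {{}} \<and> K \<subseteq> I. neg_diff (card K) d * f (card I))"
    using U(1) by (intro sum.swap_restrict) auto
  also have "\<dots> = (\<Sum>I\<in>Pow U. (\<lambda>k. - (\<Sum>j=1..k. d j) * f k) (card I))"
  proof (rule sum.cong[OF refl])
    fix I assume I: "I \<in> Pow U"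
    hence "{K. K \<in> Pow U - {{}} \<and> K \<subseteq> I} = Pow I - {{}}" by auto
    moreover have "finite I" using I U finite_subset by auto
    ultimately show "(\<Sum>K | K \<in> Pow U - {{}} \<and> K \<subseteq> I. neg_diff (card K) d * f (card I))
        = (\<lambda>k. - (\<Sum>j=1..k. d j) * f k) (card I)"
      using neg_diff_sum_nonempty[of I d] by (simp flip: sum_distrib_right)
  qed
  also have "\<dots> = (\<Sum>k\<le>?n. real (?n choose k) * (- (\<Sum>j=1..k. d j) * f k))"
    by (rule sum_Pow_card[OF U(1)])
  also have "- (\<Sum>j=1..?n. d j) * C - (\<Sum>k\<le>?n. real (?n choose k) * (- (\<Sum>j=1..k. d j) * f k))
      = (\<Sum>k\<le>?n. real (?n choose k) * f k * ((\<Sum>j=1..k. d j) - real k / ?n * (\<Sum>j=1..?n. d j)))"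
    by (rule D)
  also have "\<dots> = (\<Sum>k\<in>{1..<?n}. real (?n choose k) * f k *
           ((\<Sum>j=1..k. d j) - real k / ?n * (\<Sum>j=1..?n. d j)))"
  proof (rule sum.mono_neutral_right)
    show "\<forall>k\<in>{..?n} - {1..<?n}. real (?n choose k) * f k *
           ((\<Sum>j=1..k. d j) - real k / ?n * (\<Sum>j=1..?n. d j)) = 0"
    proof
      fix k assume "k \<in> {..?n} - {1..<?n}"
      hence "k = 0 \<or> k = ?n" by auto
      moreover have "real ?n \<noteq> 0" using U by simp
      ultimately show "real (?n choose k) * f k * ((\<Sum>j=1..k. d j) - real k / ?n * (\<Sum>j=1..?n. d j)) = 0"
        by (elim disjE) simp_all
    qed
  qed auto
  finally show ?thesis .
qed

text \<open>The \<open>k\<close>-th summand belongs to the \<open>n choose k\<close> facets indexed by \<open>k\<close>-subsets, each a product of two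
  smaller permutohedra; the last factor is the speed of such a facet, normalised so that
  translations of \<open>x\<close> contribute nothing.\<close>

theorem perm_poly_deriv_eq:
  "perm_poly_deriv n x d = (\<Sum>k\<in>{1..<n}. real (n choose k) * (perm_poly k x * perm_poly (n - k) (shift k x)) *
     ((\<Sum>j=1..k. d j) - real k / n * (\<Sum>j=1..n. d j)))"
proof (cases "n \<ge> 2")
  case False
  hence "{1..<n} = {}" by auto
  thus ?thesis by (simp add: perm_poly_deriv_def)
next
  case n: True
  let ?U = "{1..n}" and ?w = "\<lambda>k. neg_diff k x"
  let ?g = "\<lambda>k. perm_poly k x * perm_poly (n - k) (shift k x)"
  let ?R = "\<Sum>k\<in>{1..<n}. real (n choose k) * ?g k * ((\<Sum>j=1..k. d j) - real k / n * (\<Sum>j=1..n. d j))"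
  have *: "(\<Sum>J\<in>dragons {1..<n} ?U. neg_diff (card (J i)) d * (\<Prod>j\<in>{1..<n} - {i}. neg_diff (card (J j)) x))
      = fact (n - 2) * ?R" if i: "i \<in> {1..<n}" for i
  proof -
    let ?A = "{1..<n} - {i}"
    have A: "insert i ?A = {1..<n}" "finite ?A" "i \<notin> ?A" "card ?A = n - 2" "card ?U = card ?A + 2"
      using i n by auto
    have "(\<Sum>J\<in>dragons {1..<n} ?U. neg_diff (card (J i)) d * (\<Prod>j\<in>?A. neg_diff (card (J j)) x))
       = (\<Sum>K\<in>Pow ?U - {{}}. neg_diff (card K) d *
           (\<Sum>J | J \<in> ?A \<rightarrow>\<^sub>E Pow ?U \<and> J(i := K) \<in> dragons {1..<n} ?U. \<Prod>j\<in>?A. neg_diff (card (J j)) x))"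
      using dragons_insert_sum[OF A(2) _ A(3), of ?U "\<lambda>k. neg_diff k d" ?w] by (simp only: A finite_atLeastAtMost)
    also have "\<dots> = (\<Sum>K\<in>Pow ?U - {{}}. neg_diff (card K) d *
           (\<Sum>I | I \<in> Pow ?U \<and> (SOME u. u \<in> K) \<in> I \<and> \<not> K \<subseteq> I. fact (n - 2) * ?g (card I)))"
    proof (intro sum.cong refl arg_cong2[of _ _ _ _ "(*)"])
      fix K assume K: "K \<in> Pow ?U - {{}}"
      have u: "(SOME u. u \<in> K) \<in> K"
        using K by (intro some_in_eq[THEN iffD2]) auto
      have "(\<Sum>J | J \<in> ?A \<rightarrow>\<^sub>E Pow ?U \<and> J(i := K) \<in> dragons {1..<n} ?U. \<Prod>j\<in>?A. neg_diff (card (J j)) x)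
        = (\<Sum>I | I \<in> Pow ?U \<and> (SOME u. u \<in> K) \<in> I \<and> \<not> K \<subseteq> I. \<Sum>A' | A' \<in> Pow ?A \<and> card I = Suc (card A').
            dragon_sum A' I ?w * dragon_sum (?A - A') (?U - I) (\<lambda>k. \<Sum>M\<in>Pow I. neg_diff (k + card M) x))"
        using dragons_fixed_sum[OF A(2) _ A(3) _ u, of ?U ?w] K by (simp only: A) simp
      also have "\<dots> = (\<Sum>I | I \<in> Pow ?U \<and> (SOME u. u \<in> K) \<in> I \<and> \<not> K \<subseteq> I. fact (n - 2) * ?g (card I))"
      proof (rule sum.cong[OF refl])
        fix I assume "I \<in> {I. I \<in> Pow ?U \<and> (SOME u. u \<in> K) \<in> I \<and> \<not> K \<subseteq> I}"
        hence "I \<subseteq> ?U" "I \<noteq> {}" "I \<noteq> ?U" using K by auto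
        from dragon_sum_splits[OF A(2) _ A(5) this, of x]
        show "(\<Sum>A' | A' \<in> Pow ?A \<and> card I = Suc (card A').
            dragon_sum A' I ?w * dragon_sum (?A - A') (?U - I) (\<lambda>k. \<Sum>M\<in>Pow I. neg_diff (k + card M) x))
          = fact (n - 2) * ?g (card I)"
          by (simp only: A(4) finite_atLeastAtMost card_atLeastAtMost diff_Suc_1)
      qed
      finally show "(\<Sum>J | J \<in> ?A \<rightarrow>\<^sub>E Pow ?U \<and> J(i := K) \<in> dragons {1..<n} ?U. \<Prod>j\<in>?A. neg_diff (card (J j)) x)
          = \<dots>" .
    qed
    also have "\<dots> = (\<Sum>k\<in>{1..<n}. real (n choose k) * (fact (n - 2) * ?g k)
        * ((\<Sum>j=1..k. d j) - real k / n * (\<Sum>j=1..n. d j)))"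
      using sum_Pow_not_superset[of ?U d "\<lambda>k. fact (n - 2) * ?g k"] n by simp
    also have "\<dots> = fact (n - 2) * ?R"
      by (simp add: sum_distrib_left ac_simps)
    finally show ?thesis .
  qed
  have "perm_poly_deriv n x d = (\<Sum>i\<in>{1..<n}. \<Sum>J\<in>dragons {1..<n} ?U.
      neg_diff (card (J i)) d * (\<Prod>j\<in>{1..<n} - {i}. neg_diff (card (J j)) x)) / fact (n - 1)"
    unfolding perm_poly_deriv_def by (subst sum.swap) simp
  \<comment> \<open>All \<open>n - 1\<close> indices contribute the same amount, so that
    \<open>n - 1\<close> and \<open>fact (n - 2)\<close> cancel the denominator.\<close>
  also have "\<dots> = (\<Sum>i\<in>{1..<n}. fact (n - 2) * ?R) / fact (n - 1)"
    using * by (intro arg_cong2[of _ _ _ _ "(/)"] sum.cong refl)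
  also have "\<dots> = real (n - 1) * fact (n - 2) / fact (n - 1) * ?R"
    by simp
  also have "fact (n - 1) = real (n - 1) * fact (n - 2)"
    using n fact_reduce[of "n - 1", where 'a = real] by (simp add: numeral_2_eq_2)
  finally show ?thesis using n by simp
qed

section \<open>The integral recursion\<close>

definition merge_at :: "nat \<Rightarrow> real \<Rightarrow> (nat \<Rightarrow> real) \<Rightarrow> nat \<Rightarrow> real" where
  "merge_at k s x = (\<lambda>j. if j < k then x j else if j = k then x k + x (Suc k) - s else x (Suc j))"

lemma shift_merge_at: "i < k \<Longrightarrow> shift i (merge_at k s x) = merge_at (k - i) s (shift i x)"
  by (auto simp: shift_def merge_at_def fun_eq_iff)

lemma has_real_derivative_merge_at:
  "((\<lambda>s. perm_poly n (merge_at k s x)) has_real_derivative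
    perm_poly_deriv n (merge_at k s x) (\<lambda>j. if j = k then -1 else 0)) (at s)"
proof (rule has_real_derivative_perm_poly)
  fix j
  consider "j < k" | "j = k" | "j > k" by linarith
  thus "((\<lambda>s. merge_at k s x j) has_real_derivative (if j = k then -1 else 0)) (at s)"
    by cases (auto simp: merge_at_def intro!: derivative_eq_intros)
qed

lemma continuous_on_merge_at: "continuous_on S (\<lambda>s. perm_poly n (merge_at k s x))"
  by (intro continuous_at_imp_continuous_on ballI DERIV_isCont[OF has_real_derivative_merge_at])

lemma sum_merge_at_less: "i < k \<Longrightarrow> (\<Sum>j=1..i. merge_at k s x j) = (\<Sum>j=1..i. x j)"
  by (rule sum.cong) (auto simp: merge_at_def)

lemma sum_merge_at_ge:
  assumes "1 \<le> k" "k \<le> i"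
  shows "(\<Sum>j=1..i. merge_at k s x j) = (\<Sum>j=1..Suc i. x j) - s"
  using assms(2)
proof (induction i rule: dec_induct)
  case base
  obtain m where m: "k = Suc m" using assms(1) by (cases k) auto
  have "(\<Sum>j=1..m. merge_at (Suc m) s x j) = (\<Sum>j=1..m. x j)"
    by (rule sum_merge_at_less) simp
  thus ?case by (simp add: m) (simp add: merge_at_def)
next
  case (step i)
  thus ?case by simp (simp add: merge_at_def)
qed

definition slab :: "nat \<Rightarrow> (nat \<Rightarrow> real) \<Rightarrow> nat \<Rightarrow> real" where
  "slab n x k = integral {x (Suc k)..x k} (\<lambda>s. perm_poly (n - 1) (merge_at k s x))"

lemma has_integral_slab:
  "((\<lambda>s. perm_poly m (merge_at k s x)) has_integral slab (Suc m) x k) {x (Suc k)..x k}"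
  unfolding slab_def by (auto intro!: integrable_integral integrable_continuous_interval continuous_on_merge_at)

text \<open>Exchanges the position \<open>k\<close> of a slab with the size \<open>i\<close> of a
  facet when the slab lies in the tail after the first \<open>i\<close> entries, where its position
  is \<open>k - i\<close>. The next lemma does the same for slabs within an initial segment.\<close>

lemma sum_triangle_diff:
  fixes f :: "nat \<Rightarrow> nat \<Rightarrow> real"
  shows "(\<Sum>k\<in>{1..<n}. \<Sum>i\<in>{1..<k}. f i (k - i)) = (\<Sum>i\<in>{1..<n-1}. \<Sum>k\<in>{1..<n-i}. f i k)"
proof -
  have "(\<Sum>k\<in>{1..<n}. \<Sum>i\<in>{1..<k}. f i (k - i)) = (\<Sum>(k, i)\<in>Sigma {1..<n} (\<lambda>k. {1..<k}). f i (k - i))"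
    by (rule sum.Sigma) auto
  also have "\<dots> = (\<Sum>(i, k)\<in>Sigma {1..<n-1} (\<lambda>i. {1..<n-i}). f i k)"
    by (rule sum.reindex_bij_witness[where i = "\<lambda>(i, k). (k + i, i)" and j = "\<lambda>(k, i). (i, k - i)"]) auto
  also have "\<dots> = (\<Sum>i\<in>{1..<n-1}. \<Sum>k\<in>{1..<n-i}. f i k)"
    by (rule sum.Sigma[symmetric]) auto
  finally show ?thesis .
qed

lemma sum_triangle_swap:
  fixes f :: "nat \<Rightarrow> nat \<Rightarrow> real"
  shows "(\<Sum>k\<in>{1..<n}. \<Sum>i\<in>{k..<n-1}. f i k) = (\<Sum>i\<in>{1..<n-1}. \<Sum>k\<in>{1..<Suc i}. f i k)"
proof -
  have "(\<Sum>k\<in>{1..<n}. \<Sum>i\<in>{k..<n-1}. f i k) = (\<Sum>(k, i)\<in>Sigma {1..<n} (\<lambda>k. {k..<n-1}). f i k)"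
    by (rule sum.Sigma) auto
  also have "\<dots> = (\<Sum>(i, k)\<in>Sigma {1..<n-1} (\<lambda>i. {1..<Suc i}). f i k)"
    by (rule sum.reindex_bij_witness[where i = "\<lambda>(i, k). (k, i)" and j = "\<lambda>(k, i). (i, k)"]) auto
  also have "\<dots> = (\<Sum>i\<in>{1..<n-1}. \<Sum>k\<in>{1..<Suc i}. f i k)"
    by (rule sum.Sigma[symmetric]) auto
  finally show ?thesis .
qed

text \<open>Let \<open>m\<close> be the merged sequence. By Euler's relation \<open>(n - 2) P(m) = \<nabla>P(m) m\<close>. Writing
  \<open>m = c (1, \<dots>, 1) - (s - c) e\<^sub>k + d\<close>, the first summand contributes nothing, the second one combines with \<open>P(m)\<close> to the
  derivative of \<open>(s - c) P(m)\<close>, and \<open>d\<close> gives integrals over slabs of smaller permutohedra.\<close>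

lemma slab_eq:
  fixes x :: "nat \<Rightarrow> real"
  assumes k: "1 \<le> k" "k < n" and le: "x (Suc k) \<le> x k"
  defines "c \<equiv> (\<Sum>j=1..n. x j) / n"
  defines "h \<equiv> \<lambda>i. (\<Sum>j=1..i. x j) - real i * c"
  shows "real (n - 1) * slab n x k
    = (x k - c) * perm_poly (n - 1) (merge_at k (x k) x)
      - (x (Suc k) - c) * perm_poly (n - 1) (merge_at k (x (Suc k)) x)
      + (\<Sum>i\<in>{1..<k}. real (n - 1 choose i) * h i * perm_poly i x * slab (n - i) (shift i x) (k - i))
      + (\<Sum>i\<in>{k..<n-1}. real (n - 1 choose i) * h (Suc i) * perm_poly (n - Suc i) (shift (Suc i) x) * slab (Suc i) x k)"
proof -
  obtain N where n: "n = Suc N" "N \<ge> 1" using k by (cases n) auto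
  let ?I = "{x (Suc k)..x k}"
  let ?m = "\<lambda>s. merge_at k s x"
  let ?e = "\<lambda>j. if j = k then -1 else (0::real)"
  let ?p = "\<lambda>i s. real (N choose i) * (perm_poly i (?m s) * perm_poly (N - i) (shift i (?m s)))"
  \<comment> \<open>Partial sums of the merged sequence up to \<open>i\<close> involve the first
    \<open>i\<close> entries of \<open>x\<close> below \<open>k\<close>, but the first
    \<open>i + 1\<close> from \<open>k\<close> on.\<close>
  define h' where "h' i = (if i < k then h i else h (Suc i))" for i
  have nc: "(\<Sum>j=1..n. x j) = real n * c" using n by (simp add: c_def)
  have coef: "(\<Sum>j=1..i. ?m s j) - real i / N * (\<Sum>j=1..N. ?m s j)
      = h' i + (s - c) * ((\<Sum>j=1..i. ?e j) - real i / N * (\<Sum>j=1..N. ?e j))" if i: "i \<in> {1..<N}" for i s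
  proof -
    have sN: "(\<Sum>j=1..N. ?m s j) = real N * c + c - s"
      using sum_merge_at_ge[of k N s x] k n nc by (simp add: algebra_simps)
    have eN: "(\<Sum>j=1..N. ?e j) = -1" using k n by simp
    show ?thesis
    proof (cases "i < k")
      case True
      hence e: "(\<Sum>j=1..i. ?e j) = 0" by simp
      show ?thesis
        unfolding sN eN e sum_merge_at_less[OF True] h'_def h_def using True n by (simp add: field_simps)
    next
      case False
      hence "k \<le> i" by simp
      hence e: "(\<Sum>j=1..i. ?e j) = -1" using k by simp
      show ?thesis
        unfolding sN eN e sum_merge_at_ge[OF k(1) \<open>k \<le> i\<close>] h'_def h_def using False n by (simp add: field_simps)
    qed
  qed
  have pointwise: "real N * perm_poly N (?m s)
      = (perm_poly N (?m s) + (s - c) * perm_poly_deriv N (?m s) ?e) + (\<Sum>i\<in>{1..<N}. h' i * ?p i s)" for s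
  proof -
    have "real (N - 1) * perm_poly N (?m s)
        = (\<Sum>i\<in>{1..<N}. ?p i s * ((\<Sum>j=1..i. ?m s j) - real i / N * (\<Sum>j=1..N. ?m s j)))"
      using perm_poly_deriv_eq[of N "?m s" "?m s"] by (simp only: perm_poly_deriv_self)
    also have "\<dots> = (\<Sum>i\<in>{1..<N}. h' i * ?p i s
        + (s - c) * (?p i s * ((\<Sum>j=1..i. ?e j) - real i / N * (\<Sum>j=1..N. ?e j))))"
    proof (rule sum.cong[OF refl])
      fix i assume i: "i \<in> {1..<N}"
      show "?p i s * ((\<Sum>j=1..i. ?m s j) - real i / N * (\<Sum>j=1..N. ?m s j)) = h' i * ?p i s
        + (s - c) * (?p i s * ((\<Sum>j=1..i. ?e j) - real i / N * (\<Sum>j=1..N. ?e j)))"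
        unfolding coef[OF i] by (simp only: distrib_left mult_ac)
    qed
    also have "\<dots> = (\<Sum>i\<in>{1..<N}. h' i * ?p i s) + (s - c) * perm_poly_deriv N (?m s) ?e"
      by (simp only: sum.distrib perm_poly_deriv_eq[of N "?m s" ?e] sum_distrib_left)
    finally have "real (N - 1) * perm_poly N (?m s)
        = (\<Sum>i\<in>{1..<N}. h' i * ?p i s) + (s - c) * perm_poly_deriv N (?m s) ?e" .
    thus ?thesis using n by (simp add: of_nat_diff algebra_simps)
  qed
  have FTC: "((\<lambda>s. perm_poly N (?m s) + (s - c) * perm_poly_deriv N (?m s) ?e) has_integral
      ((x k - c) * perm_poly N (?m (x k)) - (x (Suc k) - c) * perm_poly N (?m (x (Suc k))))) ?I"
  proof (rule fundamental_theorem_of_calculus[OF le])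
    fix s
    have "((\<lambda>s. (s - c) * perm_poly N (?m s)) has_real_derivative
        perm_poly N (?m s) + (s - c) * perm_poly_deriv N (?m s) ?e) (at s)"
      using DERIV_mult[OF DERIV_diff[OF DERIV_ident DERIV_const[of c]] has_real_derivative_merge_at[of N k x]]
      by (simp only: diff_zero mult_1 mult.commute[of "perm_poly_deriv _ _ _"])
    from has_field_derivative_at_within[OF this]
    show "((\<lambda>s. (s - c) * perm_poly N (?m s)) has_vector_derivative
        perm_poly N (?m s) + (s - c) * perm_poly_deriv N (?m s) ?e) (at s within ?I)"
      unfolding has_real_derivative_iff_has_vector_derivative .
  qed
  let ?J = "\<lambda>i. if i < k
      then real (N choose i) * h i * perm_poly i x * slab (n - i) (shift i x) (k - i)
      else real (N choose i) * h (Suc i) * perm_poly (n - Suc i) (shift (Suc i) x) * slab (Suc i) x k"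
  \<comment> \<open>Exactly one of the two factors depends on \<open>s\<close>. Below
    \<open>k\<close> the first \<open>i\<close> entries are untouched and the merging happens in the
    tail; from \<open>k\<close> on it happens within the first \<open>i\<close> entries, and the
    tail is that of \<open>x\<close> with one more entry skipped.\<close>
  have pieces: "((\<lambda>s. h' i * ?p i s) has_integral ?J i) ?I" if i: "i \<in> {1..<N}" for i
  proof (cases "i < k")
    case True
    have "perm_poly i (?m s) = perm_poly i x" for s
      by (rule perm_poly_cong) (use True in \<open>auto simp: merge_at_def\<close>)
    hence eq: "(\<lambda>s. h' i * ?p i s)
        = (\<lambda>s. (real (N choose i) * h i * perm_poly i x) * perm_poly (N - i) (merge_at (k - i) s (shift i x)))"
      using True by (simp add: h'_def shift_merge_at fun_eq_iff)
    have "((\<lambda>s. perm_poly (N - i) (merge_at (k - i) s (shift i x))) has_integral slab (n - i) (shift i x) (k - i)) ?I"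
      using has_integral_slab[of "N - i" "k - i" "shift i x"] True i n by (simp add: shift_def Suc_diff_le)
    thus ?thesis unfolding eq using True by (simp only: if_True has_integral_mult_right)
  next
    case False
    have "perm_poly (N - i) (shift i (?m s)) = perm_poly (n - Suc i) (shift (Suc i) x)" for s
      using False n by (auto intro!: perm_poly_cong simp: merge_at_def shift_def)
    hence eq: "(\<lambda>s. h' i * ?p i s)
        = (\<lambda>s. (real (N choose i) * h (Suc i) * perm_poly (n - Suc i) (shift (Suc i) x)) * perm_poly i (?m s))"
      using False by (simp add: h'_def fun_eq_iff)
    show ?thesis unfolding eq using False has_integral_slab[of i k x]
      by (simp only: if_False has_integral_mult_right)
  qed
  have "((\<lambda>s. real N * perm_poly N (?m s)) has_integral
      ((x k - c) * perm_poly N (?m (x k)) - (x (Suc k) - c) * perm_poly N (?m (x (Suc k)))) + (\<Sum>i\<in>{1..<N}. ?J i)) ?I"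
    unfolding pointwise by (intro has_integral_add FTC has_integral_sum pieces) auto
  moreover have "((\<lambda>s. real N * perm_poly N (?m s)) has_integral real N * slab n x k) ?I"
    using has_integral_slab[of N k x] n by (simp only: has_integral_mult_right)
  ultimately have main: "real N * slab n x k =
      ((x k - c) * perm_poly N (?m (x k)) - (x (Suc k) - c) * perm_poly N (?m (x (Suc k)))) + (\<Sum>i\<in>{1..<N}. ?J i)"
    by (rule has_integral_unique[symmetric])
  have "{1..<N} = {1..<k} \<union> {k..<N}" using k n by auto
  hence "(\<Sum>i\<in>{1..<N}. ?J i) = (\<Sum>i\<in>{1..<k}. ?J i) + (\<Sum>i\<in>{k..<N}. ?J i)"
    by (simp only:) (rule sum.union_disjoint, auto)
  also have "(\<Sum>i\<in>{1..<k}. ?J i)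
      = (\<Sum>i\<in>{1..<k}. real (N choose i) * h i * perm_poly i x * slab (n - i) (shift i x) (k - i))"
    by (rule sum.cong) auto
  also have "(\<Sum>i\<in>{k..<N}. ?J i)
      = (\<Sum>i\<in>{k..<N}. real (N choose i) * h (Suc i) * perm_poly (n - Suc i) (shift (Suc i) x) * slab (Suc i) x k)"
    by (rule sum.cong) auto
  finally show ?thesis using main n(1) by (simp only: diff_Suc_1 add.assoc)
qed

text \<open>Summing \<open>slab_eq\<close> over \<open>k\<close> leaves boundary terms, which
  telescope, and slab sums of smaller sizes, which the induction hypothesis evaluates. The outcome
  is the gradient formula in direction \<open>x\<close>, hence \<open>n - 1\<close> times the
  polynomial.\<close>

theorem perm_poly_eq_sum_slab:
  fixes x :: "nat \<Rightarrow> real"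
  assumes "n \<ge> 2" "\<And>j. 1 \<le> j \<Longrightarrow> j < n \<Longrightarrow> x (Suc j) \<le> x j"
  shows "perm_poly n x = (\<Sum>k\<in>{1..<n}. slab n x k)"
  using assms
proof (induction n arbitrary: x rule: less_induct)
  case (less n x)
  define c where "c = (\<Sum>j=1..n. x j) / n"
  define h where "h i = (\<Sum>j=1..i. x j) - real i * c" for i
  define g where "g i = h i * (perm_poly i x * perm_poly (n - i) (shift i x))" for i
  obtain N where n: "n = Suc N" "N \<ge> 1" using less.prems(1) by (cases n) auto
  let ?r = "\<lambda>k. (x k - c) * perm_poly N (merge_at k (x k) x)"
  \<comment> \<open>As \<open>c\<close> is the mean, the height at \<open>n\<close> vanishes; this
    identifies \<open>x n - c\<close> with \<open>- h N\<close> and the last boundary term with a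
    facet term.\<close>
  have hn: "h n = 0" using n by (simp add: h_def c_def)
  \<comment> \<open>Merging at \<open>k\<close> or at \<open>k + 1\<close> with
    \<open>s = x (k + 1)\<close> both delete the entry \<open>x (k + 1)\<close>.\<close>
  have r_Suc: "perm_poly N (merge_at k (x (Suc k)) x) = perm_poly N (merge_at (Suc k) (x (Suc k)) x)" for k
    by (rule perm_poly_cong) (auto simp: merge_at_def less_Suc_eq)
  have "(\<Sum>k\<in>{1..<n}. (x k - c) * perm_poly N (merge_at k (x k) x)
      - (x (Suc k) - c) * perm_poly N (merge_at k (x (Suc k)) x)) = (\<Sum>k\<in>{1..<n}. ?r k - ?r (Suc k))"
    by (simp only: r_Suc)
  also have "\<dots> = ?r 1 - ?r n"
    using sum_Suc_diff'[of 1 n "\<lambda>k. - ?r k"] n by (simp add: algebra_simps)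
  also have "perm_poly N (merge_at 1 (x 1) x) = perm_poly N (shift 1 x)"
    by (rule perm_poly_cong) (auto simp: merge_at_def shift_def)
  also have "perm_poly N (merge_at n (x n) x) = perm_poly N x"
    by (rule perm_poly_cong) (auto simp: merge_at_def n)
  also have "(x 1 - c) * perm_poly N (shift 1 x) = g 1"
    by (simp add: g_def h_def n)
  also have "(x n - c) * perm_poly N x = - g N"
  proof -
    have "x n - c = - h N" using hn by (simp add: h_def n algebra_simps)
    thus ?thesis by (simp add: g_def n)
  qed
  finally have boundary: "(\<Sum>k\<in>{1..<n}. (x k - c) * perm_poly N (merge_at k (x k) x)
      - (x (Suc k) - c) * perm_poly N (merge_at k (x (Suc k)) x)) = g 1 + g N" by simp
  have "(\<Sum>k\<in>{1..<n}. \<Sum>i\<in>{1..<k}. real (N choose i) * h i * perm_poly i x * slab (n - i) (shift i x) (k - i))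
      = (\<Sum>i\<in>{1..<N}. \<Sum>k\<in>{1..<n-i}. real (N choose i) * h i * perm_poly i x * slab (n - i) (shift i x) k)"
    using sum_triangle_diff[of "\<lambda>i k. real (N choose i) * h i * perm_poly i x * slab (n - i) (shift i x) k" n] n
    by simp
  also have "\<dots> = (\<Sum>i\<in>{1..<N}. real (N choose i) * g i)"
  proof (rule sum.cong[OF refl])
    fix i assume i: "i \<in> {1..<N}"
    have "perm_poly (n - i) (shift i x) = (\<Sum>k\<in>{1..<n - i}. slab (n - i) (shift i x) k)"
      using i n less.prems(2) by (intro less.IH) (auto simp: shift_def)
    thus "(\<Sum>k\<in>{1..<n-i}. real (N choose i) * h i * perm_poly i x * slab (n - i) (shift i x) k)
        = real (N choose i) * g i"
      by (simp only: g_def sum_distrib_left[symmetric] mult.assoc)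
  qed
  finally have lower: "(\<Sum>k\<in>{1..<n}. \<Sum>i\<in>{1..<k}.
        real (N choose i) * h i * perm_poly i x * slab (n - i) (shift i x) (k - i))
      = (\<Sum>i\<in>{1..<N}. real (N choose i) * g i)" .
  have "(\<Sum>k\<in>{1..<n}. \<Sum>i\<in>{k..<N}.
        real (N choose i) * h (Suc i) * perm_poly (n - Suc i) (shift (Suc i) x) * slab (Suc i) x k)
      = (\<Sum>i\<in>{1..<N}. \<Sum>k\<in>{1..<Suc i}.
        real (N choose i) * h (Suc i) * perm_poly (n - Suc i) (shift (Suc i) x) * slab (Suc i) x k)"
    using sum_triangle_swap[of "\<lambda>i k. real (N choose i) * h (Suc i) * perm_poly (n - Suc i) (shift (Suc i) x) * slab (Suc i) x k" n] n
    by simp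
  also have "\<dots> = (\<Sum>i\<in>{1..<N}. real (N choose i) * g (Suc i))"
  proof (rule sum.cong[OF refl])
    fix i assume i: "i \<in> {1..<N}"
    have "perm_poly (Suc i) x = (\<Sum>k\<in>{1..<Suc i}. slab (Suc i) x k)"
      using i n less.prems(2) by (intro less.IH) auto
    thus "(\<Sum>k\<in>{1..<Suc i}. real (N choose i) * h (Suc i) * perm_poly (n - Suc i) (shift (Suc i) x) * slab (Suc i) x k)
        = real (N choose i) * g (Suc i)"
      unfolding g_def sum_distrib_left[symmetric] by (simp only: mult_ac)
  qed
  finally have upper: "(\<Sum>k\<in>{1..<n}. \<Sum>i\<in>{k..<N}.
        real (N choose i) * h (Suc i) * perm_poly (n - Suc i) (shift (Suc i) x) * slab (Suc i) x k)
      = (\<Sum>i\<in>{1..<N}. real (N choose i) * g (Suc i))" .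
  have "real N * (\<Sum>k\<in>{1..<n}. slab n x k) = (\<Sum>k\<in>{1..<n}.
      ((x k - c) * perm_poly N (merge_at k (x k) x) - (x (Suc k) - c) * perm_poly N (merge_at k (x (Suc k)) x))
      + (\<Sum>i\<in>{1..<k}. real (N choose i) * h i * perm_poly i x * slab (n - i) (shift i x) (k - i))
      + (\<Sum>i\<in>{k..<N}. real (N choose i) * h (Suc i) * perm_poly (n - Suc i) (shift (Suc i) x) * slab (Suc i) x k))"
    unfolding sum_distrib_left
  proof (rule sum.cong[OF refl])
    fix k assume k: "k \<in> {1..<n}"
    hence "1 \<le> k" "k < n" "x (Suc k) \<le> x k" using less.prems(2) by auto
    from slab_eq[OF this]
    show "real N * slab n x k =
      ((x k - c) * perm_poly N (merge_at k (x k) x) - (x (Suc k) - c) * perm_poly N (merge_at k (x (Suc k)) x))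
      + (\<Sum>i\<in>{1..<k}. real (N choose i) * h i * perm_poly i x * slab (n - i) (shift i x) (k - i))
      + (\<Sum>i\<in>{k..<N}. real (N choose i) * h (Suc i) * perm_poly (n - Suc i) (shift (Suc i) x) * slab (Suc i) x k)"
      unfolding h_def c_def n(1) diff_Suc_1 .
  qed
  also have "\<dots> = g 1 + g N + (\<Sum>i\<in>{1..<N}. real (N choose i) * g i) + (\<Sum>i\<in>{1..<N}. real (N choose i) * g (Suc i))"
    by (simp only: sum.distrib boundary lower upper)
  \<comment> \<open>Pascal's rule: the boundary terms \<open>g 1\<close> and \<open>g N\<close> are
    the missing extreme terms, with coefficients \<open>N choose 0\<close> and
    \<open>N choose N\<close>.\<close>
  also have "\<dots> = (\<Sum>i\<in>{1..<n}. real (n choose i) * g i)"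
  proof -
    have "(\<Sum>i\<in>{1..<n}. real (n choose i) * g i)
        = (\<Sum>i\<in>{1..<n}. real (N choose i) * g i) + (\<Sum>i\<in>{1..<n}. real (N choose (i - 1)) * g i)"
      unfolding sum.distrib[symmetric]
    proof (rule sum.cong[OF refl])
      fix i assume "i \<in> {1..<n}"
      then obtain m where "i = Suc m" by (cases i) auto
      thus "real (n choose i) * g i = real (N choose i) * g i + real (N choose (i - 1)) * g i"
        by (simp add: n algebra_simps)
    qed
    also have "(\<Sum>i\<in>{1..<n}. real (N choose i) * g i) = (\<Sum>i\<in>{1..<N}. real (N choose i) * g i) + g N"
      using n by simp
    also have "(\<Sum>i\<in>{1..<n}. real (N choose (i - 1)) * g i) = g 1 + (\<Sum>i\<in>{1..<N}. real (N choose i) * g (Suc i))"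
    proof -
      have "(\<Sum>i\<in>{1..<n}. real (N choose (i - 1)) * g i) = g 1 + (\<Sum>i\<in>{Suc 1..<Suc N}. real (N choose (i - 1)) * g i)"
        using n by (subst sum.atLeast_Suc_lessThan) auto
      also have "(\<Sum>i\<in>{Suc 1..<Suc N}. real (N choose (i - 1)) * g i) = (\<Sum>i\<in>{1..<N}. real (N choose i) * g (Suc i))"
        by (subst sum.shift_bounds_Suc_ivl) simp
      finally show ?thesis .
    qed
    finally show ?thesis by simp
  qed
  also have "\<dots> = real N * perm_poly n x"
  proof -
    have "real N * perm_poly n x = (\<Sum>k\<in>{1..<n}. real (n choose k) * (perm_poly k x * perm_poly (n - k) (shift k x)) *
         ((\<Sum>j=1..k. x j) - real k / n * (\<Sum>j=1..n. x j)))"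
      using perm_poly_deriv_eq[of n x x] by (simp add: perm_poly_deriv_self n)
    also have "\<dots> = (\<Sum>i\<in>{1..<n}. real (n choose i) * g i)"
      by (rule sum.cong) (auto simp: g_def h_def c_def)
    finally show ?thesis by simp
  qed
  finally show ?case using n by simp
qed

section \<open>Slices of the permutohedron\<close>

text \<open>For \<open>E = {1..n}\<close> these are Rado's inequalities and the equation for the sum of all coordinates;
  for smaller \<open>E\<close> they cut out the projection to the coordinates in \<open>E\<close>.\<close>

definition rado_bounds :: "nat set \<Rightarrow> nat \<Rightarrow> (nat \<Rightarrow> real) \<Rightarrow> (nat \<Rightarrow> real) \<Rightarrow> bool" where
  "rado_bounds E n x t \<longleftrightarrow> (\<forall>K\<subseteq>E. (\<Sum>i\<in>K. t i) \<le> (\<Sum>j=1..card K. x j) \<and>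
      (\<Sum>j=1..n. x j) - (\<Sum>j=1..n - card K. x j) \<le> (\<Sum>i\<in>K. t i))"

lemma rado_bounds_mono: "rado_bounds E n x t \<Longrightarrow> F \<subseteq> E \<Longrightarrow> rado_bounds F n x t"
  unfolding rado_bounds_def by blast

lemma rado_bounds_cong:
  assumes "\<And>i. i \<in> E \<Longrightarrow> t i = t' i"
  shows "rado_bounds E n x t \<longleftrightarrow> rado_bounds E n x t'"
proof -
  have "(\<Sum>i\<in>K. t i) = (\<Sum>i\<in>K. t' i)" if "K \<subseteq> E" for K
    using that assms by (intro sum.cong) auto
  thus ?thesis unfolding rado_bounds_def by (metis (no_types, lifting))
qed

lemma antimono_on_le: "antimono_on {1..n} x \<Longrightarrow> 1 \<le> i \<Longrightarrow> i \<le> j \<Longrightarrow> j \<le> n \<Longrightarrow> x j \<le> x i"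
  for x :: "nat \<Rightarrow> real"
  by (auto simp: monotone_on_def)

lemma antimono_on_merge_at:
  fixes x :: "nat \<Rightarrow> real"
  assumes x: "antimono_on {1..n} x" and k: "1 \<le> k" "k < n" and s: "x (Suc k) \<le> s" "s \<le> x k"
  shows "antimono_on {1..n - 1} (merge_at k s x)"
proof (rule monotone_onI)
  fix i j assume ij: "i \<in> {1..n - 1}" "j \<in> {1..n - 1}" "i \<le> j"
  note le = antimono_on_le[OF x]
  consider "j < k" | "i < k" "j = k" | "i < k" "j > k" | "i = k" "j = k" | "i = k" "j > k" | "i > k"
    using ij by linarith
  thus "merge_at k s x i \<ge> merge_at k s x j"
  proof cases
    case 2
    have "x k \<le> x i" using 2 ij k by (intro le) auto
    thus ?thesis using 2 s by (simp add: merge_at_def)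
  next
    case 5
    have "x (Suc j) \<le> x (Suc k)" using 5 ij k by (intro le) auto
    thus ?thesis using 5 s by (simp add: merge_at_def)
  qed (use ij k in \<open>auto simp: merge_at_def intro!: le\<close>)
qed

text \<open>With \<open>p\<close> the partial sums of \<open>x\<close>, those of the merged sequence
  are the minimum of \<open>p i\<close> and \<open>p (i + 1) - t a\<close>, because
  \<open>t a\<close> lies between \<open>x (k + 1)\<close> and \<open>x k\<close>. So one pair of
  bounds on \<open>K\<close> for the merged sequence encodes the bounds on \<open>K\<close> and on
  \<open>insert a K\<close> for \<open>x\<close>. A general \<open>F\<close> serves both the
  permutohedron and its projection.\<close>

lemma rado_bounds_slice:
  fixes x t :: "nat \<Rightarrow> real"
  assumes x: "antimono_on {1..n} x" and k: "1 \<le> k" "k < n" and s: "x (Suc k) \<le> t a" "t a \<le> x k"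
    and F: "finite F" "a \<notin> F" "card F < n"
  shows "rado_bounds (insert a F) n x t \<longleftrightarrow> rado_bounds F (n - 1) (merge_at k (t a) x) t"
proof -
  define p where "p i = (\<Sum>j=1..i. x j)" for i
  define q where "q i = (\<Sum>j=1..i. merge_at k (t a) x j)" for i
  have q: "q i = (if i < k then p i else p (Suc i) - t a)" for i
    unfolding p_def q_def using sum_merge_at_less[of i k "t a" x] sum_merge_at_ge[of k i "t a" x] k
    by (cases "i < k") auto
  have pS: "p (Suc i) = p i + x (Suc i)" for i by (simp add: p_def)
  have hi: "x (Suc i) \<le> t a" if "k \<le> i" "i < n" for i
    using antimono_on_le[OF x, of "Suc k" "Suc i"] that s by simp
  have lo: "t a \<le> x (Suc i)" if "i < k" for i
    using antimono_on_le[OF x, of "Suc i" k] that s k by simp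
  have c: "card K < n" if "K \<subseteq> F" for K
    using card_mono[OF F(1) that] F(3) by simp
  have sa: "(\<Sum>i\<in>insert a K. t i) = t a + (\<Sum>i\<in>K. t i)" "card (insert a K) = Suc (card K)" if "K \<subseteq> F" for K
    using that F finite_subset by (auto intro!: sum.insert card_insert_disjoint)
  have split: "(\<forall>K\<subseteq>insert a F. P K) \<longleftrightarrow> (\<forall>K\<subseteq>F. P K \<and> P (insert a K))" for P
  proof
    assume *: "\<forall>K\<subseteq>F. P K \<and> P (insert a K)"
    show "\<forall>K\<subseteq>insert a F. P K"
    proof (intro allI impI)
      fix K assume K: "K \<subseteq> insert a F"
      show "P K"
      proof (cases "a \<in> K")
        case True
        thus ?thesis using *[rule_format, of "K - {a}"] K by (auto simp: insert_absorb)
      next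
        case False
        thus ?thesis using *[rule_format, of K] K by auto
      qed
    qed
  qed (meson insert_mono subset_insertI2)
  show ?thesis
    unfolding rado_bounds_def p_def[symmetric] q_def[symmetric] split
  proof (intro all_cong1 imp_cong refl)
    fix K assume K: "K \<subseteq> F"
    define m where "m = card K"
    define S where "S = (\<Sum>i\<in>K. t i)"
    have m: "m < n" using c[OF K] by (simp add: m_def)
    define r where "r = n - Suc m"
    have r: "n - m = Suc r" "n - 1 - m = r" "r < n" using m by (auto simp: r_def)
    have qn: "q (n - 1) = p n - t a" using q[of "n - 1"] k by auto
    show "(((\<Sum>i\<in>K. t i) \<le> p (card K) \<and> p n - p (n - card K) \<le> (\<Sum>i\<in>K. t i)) \<and>
         (\<Sum>i\<in>insert a K. t i) \<le> p (card (insert a K)) \<and>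
          p n - p (n - card (insert a K)) \<le> (\<Sum>i\<in>insert a K. t i)) \<longleftrightarrow>
        ((\<Sum>i\<in>K. t i) \<le> q (card K) \<and> q (n - 1) - q (n - 1 - card K) \<le> (\<Sum>i\<in>K. t i))"
      unfolding sa[OF K] m_def[symmetric] S_def[symmetric] r r_def[symmetric] qn
      using q[of m] q[of r] hi[of m] lo[of m] hi[of r] lo[of r] pS[of m] pS[of r] m r(3)
      by (cases "m < k"; cases "r < k") auto
  qed
qed

lemma rado_bounds_range:
  assumes "rado_bounds (insert a F) n x t" "n \<ge> 1"
  shows "x n \<le> t a" "t a \<le> x 1"
proof -
  obtain m where m: "n = Suc m" using assms(2) by (cases n) auto
  show "x n \<le> t a" "t a \<le> x 1"
    using assms(1)[unfolded rado_bounds_def, rule_format, of "{a}"] by (simp_all add: m)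
qed

lemma antimono_interval_cases:
  fixes x :: "nat \<Rightarrow> real"
  assumes "n \<ge> 2" "x n \<le> s" "s \<le> x 1"
  shows "\<exists>k\<in>{1..<n}. x (Suc k) \<le> s \<and> s \<le> x k"
  using assms
proof (induction n rule: dec_induct)
  case base
  thus ?case by (intro bexI[of _ 1]) (auto simp: numeral_2_eq_2)
next
  case (step n)
  show ?case
  proof (cases "x n \<le> s")
    case True
    then obtain k where "k \<in> {1..<n}" "x (Suc k) \<le> s \<and> s \<le> x k" using step by auto
    thus ?thesis by (intro bexI[of _ k]) auto
  next
    case False
    thus ?thesis using step by (intro bexI[of _ n]) auto
  qed
qed

section \<open>Rado's theorem: the permutohedron as the solution set of the inequalities\<close>

lemma convex_rado_bounds: "convex {t. rado_bounds E n x t}"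
proof (rule convexI)
  fix t t' :: "nat \<Rightarrow> real" and u v :: real
  assume t: "t \<in> {t. rado_bounds E n x t}" "t' \<in> {t. rado_bounds E n x t}"
    and uv: "0 \<le> u" "0 \<le> v" "u + v = 1"
  have "(\<Sum>i\<in>K. (u *\<^sub>R t + v *\<^sub>R t') i) \<le> a" "b \<le> (\<Sum>i\<in>K. (u *\<^sub>R t + v *\<^sub>R t') i)"
    if "(\<Sum>i\<in>K. t i) \<le> a" "(\<Sum>i\<in>K. t' i) \<le> a" "b \<le> (\<Sum>i\<in>K. t i)" "b \<le> (\<Sum>i\<in>K. t' i)" for K a b
  proof -
    have e: "(\<Sum>i\<in>K. (u *\<^sub>R t + v *\<^sub>R t') i) = u * (\<Sum>i\<in>K. t i) + v * (\<Sum>i\<in>K. t' i)"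
      by (simp add: plus_fun_def scaleR_fun_def sum.distrib sum_distrib_left)
    show "(\<Sum>i\<in>K. (u *\<^sub>R t + v *\<^sub>R t') i) \<le> a"
      unfolding e using convex_bound_le[OF that(1,2) uv] .
    have "u * - (\<Sum>i\<in>K. t i) + v * - (\<Sum>i\<in>K. t' i) \<le> - b"
      using that by (intro convex_bound_le uv) auto
    thus "b \<le> (\<Sum>i\<in>K. (u *\<^sub>R t + v *\<^sub>R t') i)" unfolding e by simp
  qed
  thus "u *\<^sub>R t + v *\<^sub>R t' \<in> {t. rado_bounds E n x t}"
    using t unfolding rado_bounds_def mem_Collect_eq by blast
qed

text \<open>The largest index in \<open>S\<close> is at least \<open>card S\<close>, so its entry is
  at most \<open>x (card S)\<close>; remove it and induct.\<close>

lemma sum_le_sum_first: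
  fixes x :: "nat \<Rightarrow> real"
  assumes x: "antimono_on {1..n} x" and S: "S \<subseteq> {1..n}"
  shows "(\<Sum>i\<in>S. x i) \<le> (\<Sum>j=1..card S. x j)"
  using S
proof (induction "card S" arbitrary: S)
  case 0
  hence "S = {}" using finite_subset by fastforce
  thus ?case by simp
next
  case (Suc m S)
  have fin: "finite S" using Suc.prems finite_subset by blast
  have ne: "S \<noteq> {}" using Suc.hyps(2) by auto
  define M where "M = Max S"
  have M: "M \<in> S" using fin ne by (simp add: M_def)
  have "S \<subseteq> {1..M}" using Suc.prems fin by (auto simp: M_def)
  hence "Suc m \<le> M" using card_mono[of "{1..M}" S] Suc.hyps(2) by simp
  moreover have "M \<le> n" using M Suc.prems by auto
  ultimately have "x M \<le> x (Suc m)" using antimono_on_le[OF x, of "Suc m" M] by simp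
  moreover have cm: "m = card (S - {M})" using Suc.hyps(2) M by simp
  moreover have "(\<Sum>i\<in>S - {M}. x i) \<le> (\<Sum>j=1..m. x j)"
    using Suc.hyps(1)[OF cm] Suc.prems cm by auto
  moreover have "(\<Sum>i\<in>S. x i) = x M + (\<Sum>i\<in>S - {M}. x i)"
    using sum.remove[OF fin M] .
  ultimately show ?case by (simp flip: Suc.hyps(2))
qed

lemma rado_bounds_total:
  assumes "rado_bounds {1..n} n x t"
  shows "(\<Sum>i=1..n. t i) = (\<Sum>j=1..n. x j)"
  using assms[unfolded rado_bounds_def, rule_format, of "{1..n}"] by simp

text \<open>Given the total, the lower bound for \<open>K\<close> is the upper bound for its
  complement.\<close>

lemma rado_boundsI:
  assumes upper: "\<And>K. K \<subseteq> {1..n} \<Longrightarrow> (\<Sum>i\<in>K. t i) \<le> (\<Sum>j=1..card K. x j)"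
    and total: "(\<Sum>i=1..n. t i) = (\<Sum>j=1..n. x j)"
  shows "rado_bounds {1..n} n x t"
  unfolding rado_bounds_def
proof (intro allI impI conjI upper)
  fix K assume K: "K \<subseteq> {1..n}"
  hence "finite K" using finite_subset by blast
  hence "card ({1..n} - K) = n - card K" using K by (simp add: card_Diff_subset)
  moreover have "(\<Sum>i\<in>{1..n} - K. t i) = (\<Sum>i=1..n. t i) - (\<Sum>i\<in>K. t i)"
    using K by (intro sum_diff) auto
  ultimately show "(\<Sum>j=1..n. x j) - (\<Sum>j=1..n - card K. x j) \<le> (\<Sum>i\<in>K. t i)"
    using upper[of "{1..n} - K"] total by simp
qed

abbreviation vertex :: "nat \<Rightarrow> (nat \<Rightarrow> real) \<Rightarrow> (nat \<Rightarrow> nat) \<Rightarrow> nat \<Rightarrow> real" where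
  "vertex n x w \<equiv> (\<lambda>i. if i \<in> {1..n} then x (w i) else 0)"

lemma vertex_in_permutohedron: "w permutes {1..n} \<Longrightarrow> vertex n x w \<in> permutohedron n x"
  unfolding permutohedron_def by (rule hull_inc) blast

lemma permutohedron_subset:
  fixes x :: "nat \<Rightarrow> real"
  assumes x: "antimono_on {1..n} x"
  shows "permutohedron n x \<subseteq> {t. rado_bounds {1..n} n x t} \<inter> {t. \<forall>i. i \<notin> {1..n} \<longrightarrow> t i = 0}"
  unfolding permutohedron_def
proof (rule hull_minimal)
  have "convex {t :: nat \<Rightarrow> real. \<forall>i. i \<notin> {1..n} \<longrightarrow> t i = 0}"
    by (rule convexI) (auto simp: plus_fun_def scaleR_fun_def)
  thus "convex ({t. rado_bounds {1..n} n x t} \<inter> {t. \<forall>i. i \<notin> {1..n} \<longrightarrow> t i = 0})"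
    by (intro convex_Int convex_rado_bounds)
  have "rado_bounds {1..n} n x (vertex n x w)" if w: "w permutes {1..n}" for w
  proof (rule rado_boundsI)
    fix K assume K: "K \<subseteq> {1..n}"
    have inj: "inj_on w K" using permutes_inj[OF w] inj_on_subset by blast
    have "(\<Sum>i\<in>K. vertex n x w i) = (\<Sum>i\<in>K. x (w i))"
      using K by (intro sum.cong) auto
    also have "\<dots> = (\<Sum>i\<in>w ` K. x i)"
      using inj by (simp add: sum.reindex)
    also have "\<dots> \<le> (\<Sum>j=1..card (w ` K). x j)"
      using K permutes_image[OF w] by (intro sum_le_sum_first[OF x]) blast
    finally show "(\<Sum>i\<in>K. vertex n x w i) \<le> (\<Sum>j=1..card K. x j)"
      using inj by (simp add: card_image)
  next
    have "(\<Sum>i=1..n. vertex n x w i) = (\<Sum>i=1..n. x (w i))" by (intro sum.cong) auto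
    also have "\<dots> = (\<Sum>j=1..n. x j)"
      using sum.permute[OF w, of x] by (simp add: o_def)
    finally show "(\<Sum>i=1..n. vertex n x w i) = (\<Sum>j=1..n. x j)" .
  qed
  thus "{vertex n x w |w. w permutes {1..n}} \<subseteq> {t. rado_bounds {1..n} n x t} \<inter> {t. \<forall>i. i \<notin> {1..n} \<longrightarrow> t i = 0}"
    by auto
qed

text \<open>The values from \<open>q\<close> on are raised to make room for \<open>q\<close> at the
  new position. For \<open>q = k\<close> and \<open>q = k + 1\<close> the results differ exactly by
  exchanging the values \<open>k\<close> and \<open>k + 1\<close>.\<close>

lemma permutes_insert_value:
  assumes w: "w permutes {1..m}" and q: "1 \<le> q" "q \<le> Suc m"
  shows "(\<lambda>i. if i = Suc m then q else if i \<in> {1..m} then (if w i < q then w i else Suc (w i)) else i)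
           permutes {1..Suc m}" (is "?\<sigma> permutes _")
proof (rule inj_imp_permutes)
  have wm: "w i \<in> {1..m}" if "i \<in> {1..m}" for i using permutes_in_image[OF w] that by blast
  show "?\<sigma> i \<in> {1..Suc m}" if "i \<in> {1..Suc m}" for i
    using wm[of i] that q by auto
  show "inj_on ?\<sigma> {1..Suc m}"
  proof (rule inj_onI)
    fix i j assume ij: "i \<in> {1..Suc m}" "j \<in> {1..Suc m}" "?\<sigma> i = ?\<sigma> j"
    have ne: "?\<sigma> l \<noteq> q" if "l \<in> {1..Suc m}" "l \<noteq> Suc m" for l using that by auto
    show "i = j"
    proof (cases "i = Suc m \<or> j = Suc m")
      case True
      thus ?thesis using ne[of i] ne[of j] ij by metis
    next
      case False
      hence m: "i \<in> {1..m}" "j \<in> {1..m}" using ij by auto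
      hence "w i = w j" using ij(3) False by (auto split: if_splits)
      thus ?thesis using permutes_inj[OF w] by (simp add: inj_eq)
    qed
  qed
qed auto

text \<open>The points whose extension by \<open>s\<close> lies in the larger permutohedron form a
  convex set, so vertices suffice. An extended vertex lies on the segment between two vertices whose
  last coordinates are \<open>x k\<close> and \<open>x (k + 1)\<close>; where \<open>w i = k\<close>
  they have the other of these two values, which gives the merged entry.\<close>

lemma permutohedron_slice:
  fixes x t :: "nat \<Rightarrow> real"
  assumes k: "1 \<le> k" "k \<le> m" and s: "x (Suc k) \<le> s" "s \<le> x k"
    and t: "t \<in> permutohedron m (merge_at k s x)"
  shows "t(Suc m := s) \<in> permutohedron (Suc m) x"
proof -
  obtain l where l: "0 \<le> l" "l \<le> 1" and sl: "s = l * x k + (1 - l) * x (Suc k)"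
  proof (cases "x k = x (Suc k)")
    case True
    thus ?thesis using that[of 0] s by auto
  next
    case False
    hence pos: "x k - x (Suc k) > 0" using s by simp
    show ?thesis
    proof (rule that[of "(s - x (Suc k)) / (x k - x (Suc k))"])
      show "s = (s - x (Suc k)) / (x k - x (Suc k)) * x k + (1 - (s - x (Suc k)) / (x k - x (Suc k))) * x (Suc k)"
        using pos by (simp add: divide_simps) (simp add: algebra_simps)
    qed (use pos s in \<open>auto simp: divide_simps\<close>)
  qed
  have "permutohedron m (merge_at k s x) \<subseteq> {t. t(Suc m := s) \<in> permutohedron (Suc m) x}"
    unfolding permutohedron_def[of m]
  proof (rule hull_minimal)
    show "convex {t. t(Suc m := s) \<in> permutohedron (Suc m) x}"
    proof (rule convexI)
      fix t t' :: "nat \<Rightarrow> real" and u v :: real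
      assume h: "t \<in> {t. t(Suc m := s) \<in> permutohedron (Suc m) x}"
        "t' \<in> {t. t(Suc m := s) \<in> permutohedron (Suc m) x}" and uv: "0 \<le> u" "0 \<le> v" "u + v = 1"
      have "s = u * s + v * s" using uv by (metis distrib_right mult_1)
      hence "(u *\<^sub>R t + v *\<^sub>R t')(Suc m := s) = u *\<^sub>R (t(Suc m := s)) + v *\<^sub>R (t'(Suc m := s))"
        by (auto simp: fun_eq_iff plus_fun_def scaleR_fun_def)
      moreover have "convex (permutohedron (Suc m) x)"
        unfolding permutohedron_def by simp
      ultimately show "u *\<^sub>R t + v *\<^sub>R t' \<in> {t. t(Suc m := s) \<in> permutohedron (Suc m) x}"
        using h uv by (auto dest: convexD)
    qed
    show "{vertex m (merge_at k s x) w |w. w permutes {1..m}} \<subseteq> {t. t(Suc m := s) \<in> permutohedron (Suc m) x}"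
    proof clarify
      fix w assume w: "w permutes {1..m}"
      define \<sigma> where "\<sigma> q = (\<lambda>i. if i = Suc m then q else if i \<in> {1..m} then (if w i < q then w i else Suc (w i)) else i)" for q
      have "vertex (Suc m) x (\<sigma> q) \<in> permutohedron (Suc m) x" if "1 \<le> q" "q \<le> Suc m" for q
        unfolding \<sigma>_def by (rule vertex_in_permutohedron[OF permutes_insert_value[OF w that]])
      hence v: "vertex (Suc m) x (\<sigma> k) \<in> permutohedron (Suc m) x"
        "vertex (Suc m) x (\<sigma> (Suc k)) \<in> permutohedron (Suc m) x" using k by auto
      have "(vertex m (merge_at k s x) w)(Suc m := s)
          = l *\<^sub>R vertex (Suc m) x (\<sigma> k) + (1 - l) *\<^sub>R vertex (Suc m) x (\<sigma> (Suc k))"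
      proof
        fix i
        consider "i = Suc m" | "i \<in> {1..m}" "w i < k" | "i \<in> {1..m}" "w i = k" | "i \<in> {1..m}" "w i > k"
          | "i \<notin> {1..Suc m}" by fastforce
        thus "((vertex m (merge_at k s x) w)(Suc m := s)) i
          = (l *\<^sub>R vertex (Suc m) x (\<sigma> k) + (1 - l) *\<^sub>R vertex (Suc m) x (\<sigma> (Suc k))) i"
          by cases (auto simp: plus_fun_def scaleR_fun_def merge_at_def \<sigma>_def sl algebra_simps)
      qed
      thus "(vertex m (merge_at k s x) w)(Suc m := s) \<in> permutohedron (Suc m) x"
        using v l convexD[of "permutohedron (Suc m) x" _ _ l "1 - l"] by (simp add: permutohedron_def)
    qed
  qed
  thus ?thesis using t by blast
qed

theorem permutohedron_eq:
  fixes x :: "nat \<Rightarrow> real"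
  assumes "n \<ge> 1" "antimono_on {1..n} x"
  shows "permutohedron n x = {t. rado_bounds {1..n} n x t \<and> (\<forall>i. i \<notin> {1..n} \<longrightarrow> t i = 0)}"
proof
  show "permutohedron n x \<subseteq> {t. rado_bounds {1..n} n x t \<and> (\<forall>i. i \<notin> {1..n} \<longrightarrow> t i = 0)}"
    using permutohedron_subset[OF assms(2)] by blast
  have "t \<in> permutohedron n x" if "rado_bounds {1..n} n x t" "\<forall>i. i \<notin> {1..n} \<longrightarrow> t i = 0" for t
    using assms that
  proof (induction n arbitrary: x t rule: nat_induct_at_least)
    case base
    have "t 1 = x 1" using rado_bounds_total[OF base(2)] by simp
    have "t = vertex 1 x id"
    proof
      fix i show "t i = vertex 1 x id i"
        using base(3) \<open>t 1 = x 1\<close> by (cases "i = 1") auto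
    qed
    thus ?case using vertex_in_permutohedron[OF permutes_id] by (simp only:)
  next
    case (Suc m x t)
    \<comment> \<open>Points of the smaller permutohedron vanish at \<open>Suc m\<close>, so the
      fixed coordinate is reset before the induction hypothesis applies.\<close>
    let ?t = "t(Suc m := 0)"
    have ins: "{1..Suc m} = insert (Suc m) {1..m}" by auto
    have "x (Suc m) \<le> t (Suc m)" "t (Suc m) \<le> x 1"
      using rado_bounds_range[OF Suc.prems(2)[unfolded ins]] by simp_all
    then obtain k where k: "1 \<le> k" "k \<le> m" and s: "x (Suc k) \<le> t (Suc m)" "t (Suc m) \<le> x k"
      using antimono_interval_cases[of "Suc m" x "t (Suc m)"] Suc.hyps by auto
    have "rado_bounds {1..m} m (merge_at k (t (Suc m)) x) t"
      using rado_bounds_slice[OF Suc.prems(1), of k t "Suc m" "{1..m}"] k s Suc.prems(2) ins by simp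
    hence "rado_bounds {1..m} m (merge_at k (t (Suc m)) x) ?t"
      by (subst rado_bounds_cong[of _ _ t]) auto
    moreover have "\<forall>i. i \<notin> {1..m} \<longrightarrow> ?t i = 0"
      using Suc.prems(3) by auto
    moreover have "antimono_on {1..m} (merge_at k (t (Suc m)) x)"
      using antimono_on_merge_at[OF Suc.prems(1), of k] k s by simp
    ultimately have "?t \<in> permutohedron m (merge_at k (t (Suc m)) x)"
      by (intro Suc.IH)
    from permutohedron_slice[OF k s this] show ?case by simp
  qed
  thus "{t. rado_bounds {1..n} n x t \<and> (\<forall>i. i \<notin> {1..n} \<longrightarrow> t i = 0)} \<subseteq> permutohedron n x"
    by blast
qed

section \<open>Volume by slicing\<close>

definition projection :: "nat \<Rightarrow> (nat \<Rightarrow> real) \<Rightarrow> (nat \<Rightarrow> real) set" where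
  "projection n x = {t \<in> extensional {1..<n}. rado_bounds {1..<n} n x t}"

text \<open>The dropped coordinate is recovered from the total. An upper bound on a set containing
  \<open>n\<close> then becomes a lower bound on its complement, which explains why the projection
  keeps both kinds of bounds.\<close>

lemma projection_permutohedron:
  fixes x :: "nat \<Rightarrow> real"
  assumes "n \<ge> 1" "antimono_on {1..n} x"
  shows "(\<lambda>t. restrict t {1..<n}) ` permutohedron n x = projection n x"
proof
  have "restrict t {1..<n} \<in> projection n x" if "rado_bounds {1..n} n x t" for t
  proof -
    have "rado_bounds {1..<n} n x t"
      using that by (rule rado_bounds_mono) auto
    hence "rado_bounds {1..<n} n x (restrict t {1..<n})"
      by (subst rado_bounds_cong[of _ _ t]) auto
    thus ?thesis by (simp add: projection_def)
  qed
  thus "(\<lambda>t. restrict t {1..<n}) ` permutohedron n x \<subseteq> projection n x"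
    using permutohedron_eq[OF assms] by auto
next
  show "projection n x \<subseteq> (\<lambda>t. restrict t {1..<n}) ` permutohedron n x"
  proof
    fix t assume t: "t \<in> projection n x"
    define p where "p i = (\<Sum>j=1..i. x j)" for i
    define u where "u i = (if i \<in> {1..<n} then t i else if i = n then p n - (\<Sum>i\<in>{1..<n}. t i) else 0)" for i
    have b: "(\<Sum>i\<in>K. t i) \<le> p (card K)" "p n - p (n - card K) \<le> (\<Sum>i\<in>K. t i)" if "K \<subseteq> {1..<n}" for K
      using t that unfolding projection_def rado_bounds_def p_def by auto
    have sum_u: "(\<Sum>i\<in>K. u i) = (\<Sum>i\<in>K. t i)" if "K \<subseteq> {1..<n}" for K
      using that by (intro sum.cong) (auto simp: u_def)
    have ins: "{1..n} = insert n {1..<n}" using assms(1) by auto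
    have un: "u n = p n - (\<Sum>i\<in>{1..<n}. t i)" by (simp add: u_def)
    have "rado_bounds {1..n} n x u"
    proof (rule rado_boundsI)
      show "(\<Sum>i=1..n. u i) = (\<Sum>j=1..n. x j)"
        unfolding ins using sum_u[of "{1..<n}"] ins by (simp add: un p_def)
      fix K assume K: "K \<subseteq> {1..n}"
      have finK: "finite K" using K finite_subset by blast
      show "(\<Sum>i\<in>K. u i) \<le> (\<Sum>j=1..card K. x j)"
      proof (cases "n \<in> K")
        case False
        hence "K \<subseteq> {1..<n}" using K by (auto simp: le_less)
        thus ?thesis using b(1) sum_u by (simp add: p_def)
      next
        case True
        \<comment> \<open>\<open>?C\<close> is the complement of \<open>K\<close> in
          \<open>{1..n}\<close>, written inside \<open>{1..<n}\<close>; hence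
          \<open>n - card ?C = card K\<close>, and the lower bound on \<open>?C\<close> is the
          claim.\<close>
        let ?K = "K - {n}" and ?C = "{1..<n} - (K - {n})"
        have K': "?K \<subseteq> {1..<n}" using K by (auto simp: le_less)
        have "card ?K = card K - 1" "card K \<ge> 1"
          using True finK by (auto simp: Suc_le_eq card_gt_0_iff)
        moreover have "card ?C = card {1..<n} - card ?K"
          using K' finK by (intro card_Diff_subset) auto
        moreover have "card ?K \<le> n - 1"
          using card_mono[OF _ K'] by simp
        ultimately have "n - card ?C = card K"
          using assms(1) by simp
        moreover have "(\<Sum>i\<in>K. u i) = u n + (\<Sum>i\<in>?K. t i)"
          using sum.remove[OF finK True, of u] sum_u[OF K'] by simp
        moreover have "(\<Sum>i\<in>?C. t i) = (\<Sum>i\<in>{1..<n}. t i) - (\<Sum>i\<in>?K. t i)"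
          using K' by (intro sum_diff) auto
        ultimately show ?thesis
          using b(2)[of ?C] by (simp add: un p_def)
      qed
    qed
    moreover have "\<forall>i. i \<notin> {1..n} \<longrightarrow> u i = 0"
      using assms(1) by (auto simp: u_def)
    moreover have "restrict u {1..<n} = t"
      using t by (auto simp: u_def projection_def fun_eq_iff extensional_def)
    ultimately show "t \<in> (\<lambda>t. restrict t {1..<n}) ` permutohedron n x"
      using permutohedron_eq[OF assms] by (intro image_eqI[of _ _ u]) auto
  qed
qed

section \<open>Measurability, disjointness of the slabs and Fubini\<close>

lemma projection_sets: "projection n x \<in> sets (Pi\<^sub>M {1..<n} (\<lambda>_. lborel))"
proof -
  let ?M = "Pi\<^sub>M {1..<n} (\<lambda>_. lborel :: real measure)"
  have [measurable]: "(\<lambda>t. \<Sum>i\<in>K. t i) \<in> borel_measurable ?M" if "K \<in> Pow {1..<n}" for K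
  proof (rule borel_measurable_sum)
    fix i assume "i \<in> K"
    hence "i \<in> {1..<n}" using that by auto
    thus "(\<lambda>t. t i) \<in> borel_measurable ?M"
      using measurable_component_singleton[of i "{1..<n}" "\<lambda>_. lborel :: real measure"] by simp
  qed
  have "projection n x = {t \<in> space ?M. \<forall>K\<in>Pow {1..<n}. (\<Sum>i\<in>K. t i) \<le> (\<Sum>j=1..card K. x j) \<and>
      (\<Sum>j=1..n. x j) - (\<Sum>j=1..n - card K. x j) \<le> (\<Sum>i\<in>K. t i)}"
    by (auto simp: projection_def rado_bounds_def space_PiM PiE_def)
  also have "\<dots> \<in> sets ?M"
  proof (rule sets.sets_Collect_finite_All')
    fix K assume K: "K \<in> Pow {1..<n}"
    note [measurable] = this
    show "{t \<in> space ?M. (\<Sum>i\<in>K. t i) \<le> (\<Sum>j=1..card K. x j) \<and>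
      (\<Sum>j=1..n. x j) - (\<Sum>j=1..n - card K. x j) \<le> (\<Sum>i\<in>K. t i)} \<in> sets ?M"
      by measurable
  qed auto
  finally show ?thesis .
qed

lemma projection_slice:
  fixes x :: "nat \<Rightarrow> real"
  assumes x: "antimono_on {1..Suc m} x" and k: "1 \<le> k" "k \<le> m" and s: "x (Suc k) \<le> s" "s \<le> x k"
    and t: "t \<in> extensional {1..<m}"
  shows "t(m := s) \<in> projection (Suc m) x \<longleftrightarrow> t \<in> projection m (merge_at k s x)"
proof -
  have ins: "{1..<Suc m} = insert m {1..<m}" using k by auto
  have "t(m := s) \<in> extensional {1..<Suc m}"
    using t k by (auto simp: extensional_def)
  moreover have "rado_bounds {1..<Suc m} (Suc m) x (t(m := s))
      \<longleftrightarrow> rado_bounds {1..<m} m (merge_at k s x) (t(m := s))"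
    unfolding ins using rado_bounds_slice[OF x, of k "t(m := s)" m "{1..<m}"] k s by simp
  moreover have "rado_bounds {1..<m} m (merge_at k s x) (t(m := s)) \<longleftrightarrow> rado_bounds {1..<m} m (merge_at k s x) t"
    by (rule rado_bounds_cong) auto
  ultimately show ?thesis using t by (simp add: projection_def)
qed

lemma unique_interval:
  fixes x :: "nat \<Rightarrow> real"
  assumes x: "antimono_on {1..n} x" and ij: "i \<in> {1..<n}" "j \<in> {1..<n}"
    and s: "x (Suc i) < s" "s \<le> x i" "x (Suc j) < s" "s \<le> x j"
  shows "i = j"
proof (rule ccontr)
  assume "i \<noteq> j"
  then consider "Suc i \<le> j" | "Suc j \<le> i" by linarith
  thus False
  proof cases
    case 1
    have "x j \<le> x (Suc i)" using 1 ij by (intro antimono_on_le[OF x]) auto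
    thus False using s by simp
  next
    case 2
    have "x i \<le> x (Suc j)" using 2 ij by (intro antimono_on_le[OF x]) auto
    thus False using s by simp
  qed
qed

text \<open>Nonnegativity belongs to the induction: \<open>ennreal\<close> sends negative reals to
  0, so the equation of measures alone would not control the sign, and identifying the Lebesgue
  integral over a slab with \<open>slab\<close> requires a nonnegative integrand.\<close>

theorem emeasure_projection:
  fixes x :: "nat \<Rightarrow> real"
  assumes "n \<ge> 1" "antimono_on {1..n} x"
  shows "emeasure (Pi\<^sub>M {1..<n} (\<lambda>_. lborel)) (projection n x) = ennreal (perm_poly n x) \<and> 0 \<le> perm_poly n x"
  using assms
proof (induction n arbitrary: x rule: nat_induct_at_least)
  case (base x)
  have "projection 1 x = {\<lambda>_. undefined}"
    by (auto simp: projection_def rado_bounds_def)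
  thus ?case by (simp add: PiM_empty)
next
  case (Suc m x)
  interpret product_sigma_finite "\<lambda>_ :: nat. lborel :: real measure" ..
  let ?M = "Pi\<^sub>M {1..<m} (\<lambda>_. lborel :: real measure)"
  let ?V = "\<lambda>k s. perm_poly m (merge_at k s x)"
  have ins: "{1..<Suc m} = insert m {1..<m}" using Suc.hyps by auto
  have le: "x (Suc k) \<le> x k" if "k \<in> {1..<Suc m}" for k
    using that by (intro antimono_on_le[OF Suc.prems]) auto
  have V: "emeasure ?M (projection m (merge_at k s x)) = ennreal (?V k s)" "0 \<le> ?V k s"
    if "k \<in> {1..<Suc m}" "s \<in> {x (Suc k)..x k}" for k s
    using Suc.IH[of "merge_at k s x"] antimono_on_merge_at[OF Suc.prems, of k s] that by auto
  have slab_nonneg: "0 \<le> slab (Suc m) x k" if "k \<in> {1..<Suc m}" for k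
    by (rule has_integral_nonneg[OF has_integral_slab]) (rule V(2)[OF that])
  have slice: "(\<integral>\<^sup>+ t. indicator (projection (Suc m) x) (t(m := s)) \<partial>?M)
      = (\<Sum>k\<in>{1..<Suc m}. ennreal (?V k s) * indicator {x (Suc k)..x k} s)" if s: "s \<notin> x ` {1..Suc m}" for s
  proof (cases "x (Suc m) \<le> s \<and> s \<le> x 1")
    case True
    then obtain k where k: "k \<in> {1..<Suc m}" and sk: "x (Suc k) \<le> s" "s \<le> x k"
      using antimono_interval_cases[of "Suc m" x s] Suc.hyps by auto
    have strict: "x (Suc j) < s" if "j \<in> {1..<Suc m}" "x (Suc j) \<le> s" for j
      using that s by (metis atLeastAtMost_iff atLeastLessThan_iff imageI le_SucI less_Suc_eq_le not_less_eq_eq order_le_less)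
    have "(\<Sum>j\<in>{1..<Suc m}. ennreal (?V j s) * indicator {x (Suc j)..x j} s)
        = (\<Sum>j\<in>{1..<Suc m}. if j = k then ennreal (?V k s) else 0)"
    proof (rule sum.cong[OF refl])
      fix j assume j: "j \<in> {1..<Suc m}"
      show "ennreal (?V j s) * indicator {x (Suc j)..x j} s = (if j = k then ennreal (?V k s) else 0)"
      proof (cases "j = k")
        case False
        hence "s \<notin> {x (Suc j)..x j}"
          using unique_interval[OF Suc.prems j k, of s] strict[OF j] strict[OF k sk(1)] sk by auto
        thus ?thesis using False by simp
      qed (use sk in auto)
    qed
    also have "\<dots> = ennreal (?V k s)" using k by simp
    also have "\<dots> = (\<integral>\<^sup>+ t. indicator (projection m (merge_at k s x)) t \<partial>?M)"
      using V(1)[of k s] k sk projection_sets by simp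
    also have "\<dots> = (\<integral>\<^sup>+ t. indicator (projection (Suc m) x) (t(m := s)) \<partial>?M)"
    proof (rule nn_integral_cong)
      fix t assume "t \<in> space ?M"
      hence "t \<in> extensional {1..<m}" by (auto simp: space_PiM PiE_def)
      from projection_slice[OF Suc.prems _ _ sk this] k
      show "indicator (projection m (merge_at k s x)) t = (indicator (projection (Suc m) x) (t(m := s)) :: ennreal)"
        by (simp add: indicator_def)
    qed
    finally show ?thesis by simp
  next
    case False
    have "t(m := s) \<notin> projection (Suc m) x" for t
      using rado_bounds_range[of m "{1..<m}" "Suc m" x "t(m := s)"] False
      unfolding projection_def ins by auto
    moreover have "s \<notin> {x (Suc k)..x k}" if "k \<in> {1..<Suc m}" for k
      using that False antimono_on_le[OF Suc.prems, of 1 k] antimono_on_le[OF Suc.prems, of "Suc k" "Suc m"] by auto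
    ultimately show ?thesis by simp
  qed
  have "emeasure (Pi\<^sub>M {1..<Suc m} (\<lambda>_. lborel)) (projection (Suc m) x)
      = (\<integral>\<^sup>+ t. indicator (projection (Suc m) x) t \<partial>(Pi\<^sub>M {1..<Suc m} (\<lambda>_. lborel)))"
    using projection_sets by simp
  also have "\<dots> = (\<integral>\<^sup>+ s. \<integral>\<^sup>+ t. indicator (projection (Suc m) x) (t(m := s)) \<partial>?M \<partial>lborel)"
    using projection_sets[of "Suc m" x] unfolding ins
    by (intro product_nn_integral_insert_rev borel_measurable_indicator) auto
  also have "\<dots> = (\<integral>\<^sup>+ s. (\<Sum>k\<in>{1..<Suc m}. ennreal (?V k s) * indicator {x (Suc k)..x k} s) \<partial>lborel)"
  proof (rule nn_integral_cong_AE)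
    \<comment> \<open>At an entry of \<open>x\<close> several closed slabs may meet and the sum
      would count the slice more than once; these finitely many values form a null set.\<close>
    have "AE s in lborel. s \<notin> x ` {1..Suc m}"
      by (intro AE_not_in finite_imp_null_set_lborel) auto
    thus "AE s in lborel. (\<integral>\<^sup>+ t. indicator (projection (Suc m) x) (t(m := s)) \<partial>?M)
        = (\<Sum>k\<in>{1..<Suc m}. ennreal (?V k s) * indicator {x (Suc k)..x k} s)"
      by (rule AE_mp) (intro AE_I2 impI slice)
  qed
  also have "\<dots> = (\<Sum>k\<in>{1..<Suc m}. \<integral>\<^sup>+ s. ennreal (?V k s) * indicator {x (Suc k)..x k} s \<partial>lborel)"
  proof (rule nn_integral_sum)
    fix k
    have "(\<lambda>s. ?V k s) \<in> borel_measurable borel"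
      by (rule borel_measurable_continuous_onI[OF continuous_on_merge_at])
    thus "(\<lambda>s. ennreal (?V k s) * indicator {x (Suc k)..x k} s) \<in> borel_measurable lborel"
      by measurable
  qed
  also have "\<dots> = (\<Sum>k\<in>{1..<Suc m}. ennreal (slab (Suc m) x k))"
    by (rule sum.cong[OF refl], rule nn_integral_has_integral_lebesgue'[OF _ has_integral_slab]) (rule V(2))
  also have "\<dots> = ennreal (\<Sum>k\<in>{1..<Suc m}. slab (Suc m) x k)"
    by (rule sum_ennreal) (rule slab_nonneg)
  also have "(\<Sum>k\<in>{1..<Suc m}. slab (Suc m) x k) = perm_poly (Suc m) x"
    using le Suc.hyps by (intro perm_poly_eq_sum_slab[symmetric]) auto
  finally have "emeasure (Pi\<^sub>M {1..<Suc m} (\<lambda>_. lborel)) (projection (Suc m) x) = ennreal (perm_poly (Suc m) x)" .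
  moreover have "0 \<le> perm_poly (Suc m) x"
  proof -
    have "0 \<le> (\<Sum>k\<in>{1..<Suc m}. slab (Suc m) x k)"
      by (rule sum_nonneg) (rule slab_nonneg)
    also have "\<dots> = perm_poly (Suc m) x"
      using le Suc.hyps by (intro perm_poly_eq_sum_slab[symmetric]) auto
    finally show ?thesis .
  qed
  ultimately show ?case by simp
qed

text \<open>Index sets here are finite, so \<open>k \<ge> 1\<close> says precisely that
  \<open>I\<close> is nonempty, and \<open>k\<close> can be eliminated.\<close>

lemma dragon_collections_eq: "dragon_collections n = dragons {1..<n} {1..n}"
proof -
  have "(\<forall>k\<ge>1. \<forall>I\<subseteq>{1..<n}. card I = k \<longrightarrow> card (\<Union>i\<in>I. J i) \<ge> k + 1)
      \<longleftrightarrow> (\<forall>I\<subseteq>{1..<n}. I \<noteq> {} \<longrightarrow> card I < card (\<Union>i\<in>I. J i))" for J :: "nat \<Rightarrow> nat set"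
  proof -
    have "1 \<le> card I \<longleftrightarrow> I \<noteq> {}" if "I \<subseteq> {1..<n}" for I
      using that finite_subset by (auto simp: Suc_le_eq card_gt_0_iff)
    thus ?thesis by (auto simp: Suc_le_eq)
  qed
  thus ?thesis unfolding dragon_collections_def dragons_def by simp
qed

theorem theorem5p1:
  fixes n :: nat and x y :: "nat \<Rightarrow> real"
  assumes "n \<ge> 1"
    and "antimono_on {1..n} x"
    and "\<And>k. k \<in> {1..n} \<Longrightarrow>
           y k = - (\<Sum>j = 0..k - 1. (-1) ^ j * real ((k - 1) choose j) * x (k - j))"
  shows "hyperplane_vol n (permutohedron n x) =
           1 / fact (n - 1) *
             (\<Sum>J\<in>dragon_collections n. \<Prod>i\<in>{1..<n}. y (card (J i)))"
proof -
  have "hyperplane_vol n (permutohedron n x) = perm_poly n x"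
    using emeasure_projection[OF assms(1,2)]
    unfolding hyperplane_vol_def projection_permutohedron[OF assms(1,2)] by (simp add: measure_def)
  \<comment> \<open>\<open>y\<close> is known only on \<open>{1..n}\<close>; this is enough because
    the members of a dragon collection have between 2 and \<open>n\<close> elements.\<close>
  moreover have "dragon_sum {1..<n} {1..n} (\<lambda>k. neg_diff k x) = dragon_sum {1..<n} {1..n} y"
    using assms(3) by (intro dragon_sum_cong) (auto simp: neg_diff_def)
  hence "perm_poly n x = 1 / fact (n - 1) * dragon_sum {1..<n} {1..n} y"
    by (simp add: perm_poly_def)
  ultimately show ?thesis
    by (simp add: dragon_sum_def dragon_collections_eq)
qed

end
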